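(* Let $\mathcal L=\widetilde{sl_q(n)}$ be the (multiparameter) $n^2$-dimensional matrix braided Lie algebra with basis $X^i{}_j$ described in the context, let $\underline{\mathrm{tr}}=\sum_iX^i{}_iq^{2i}$, and suppose $\varepsilon(\underline{\mathrm{tr}})\neq0$, i.e. $q^{2n}\neq1$. Then $\widetilde{sl_q(n)}=k\,\underline{\mathrm{tr}}\oplus sl_q(n)$ in the braided category, where $sl_q(n)=\ker\varepsilon$ is $$sl_q(n)=\mathrm{span}\{X^i{}_j,\ h_k\mid i\neq j;\ k=1,\dots,n-1\},\qquad h_i:=X^i{}_i-X^{i+1}{}_{i+1}.$$ With $\mu=q-q^{-1}$, $H_i:=\sum_{a<i}[a]_{q^2}h_a$, $[a]_{q^2}:=\frac{1-q^{2a}}{1-q^2}$, the brackets are as follows. (i) $[x,\underline{\mathrm{tr}}]=0$, $[\underline{\mathrm{tr}},\underline{\mathrm{tr}}]=\varepsilon(\underline{\mathrm{tr}})\underline{\mathrm{tr}}$, $[\underline{\mathrm{tr}},x]=\varepsilon(\underline{\mathrm{tr}})\lambda x$ for all $x\in sl_q(n)$, with $\lambda=1+\mu^2$. (ii.a) $[h_i,h_i]=-\mu^2[2]_{q^2}q^{-2i}H_i-\mu^2q^{-2i}[i+1]_{q^2}h_i$, $[h_i,h_{i+1}]=\mu^2q^{-2i}H_{i+1}$, $[h_i,h_{i-1}]=\mu^2q^{-2(i-1)}H_i$, and $[h_i,h_j]=0$ for $|i-j|>1$. (ii.b) For $k\neq l$: $$[h_i,X^k{}_l]=\mu X^k{}_l\big(q^{-2i}(q^{-1}\delta_{k,i+1}-q\delta_{ki})+q^{-1}\delta_{li}-q\delta_{l,i+1}\big),$$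 $$[X^k{}_l,h_i]=\mu X^k{}_l\big(q^{-1}\delta_{ki}-q\delta_{k,i+1}+q^{-2i}(q^{-1}\delta_{l,i+1}-q\delta_{li})\big).$$ (ii.c) For $i\neq j$, $k\neq l$: $$[X^i{}_j,X^k{}_l]=-q\mu q^{-2j}\delta_{kj}X^i{}_l+\mu\delta_{il}\sigma_{ijk}X^k{}_j+q\mu\delta_{il}\delta_{jk}q^{-2k}X^k{}_k-\mu^2\delta_{il}\delta_{jk}q^{-2(k-1)}H_k.$$
   Context: Indices run over $1,\dots,n$; repeated upper/lower indices are summed in R-matrix formulas. $k$ is a field, $q\in k^\times$; $\theta_{ij}=1$ if $i>j$ and $0$ otherwise. $r_{ij}\in k^\times$ ($i<j$) are parameters with $\prod_{i<j}\frac{r_{ij}}q=\prod_{i>j}\frac{r_{ji}}q$ for all $j$ (the standard case is $r_{ij}=q$). The R-matrix is $$R^i{}_k{}^j{}_l=\delta^i_k\delta^j_lM_{ij}+\delta^i_l\delta^j_kL_{ij},\quad M_{ij}=q\delta_{ij}+\theta_{ji}\tfrac q{r_{ij}}+\theta_{ij}\tfrac{r_{ji}}q,\quad L_{ij}=\theta_{ji}(q-q^{-1}).$$ $(R^{-1})^i{}_k{}^j{}_l=\delta^i_k\delta^j_lM_{ij}^{-1}-\delta^i_l\delta^j_kL_{ij}$ is its inverse, and $\tilde R^i{}_k{}^j{}_l=(R^{-1})^i{}_k{}^j{}_l\,q^{2(l-j)}$ its second inverse. For $i,j,k$ distinct, $\sigma_{ijk}=\Big(\frac{q\,r_{\sigma(k),\sigma(i)}}{r_{\sigma(j),\sigma(i)}\,r_{\sigma(k),\sigma(j)}}\Big)^{(-1)^{l(\sigma)}}$,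 where $\sigma$ is the unique permutation of $\{i,j,k\}$ with $\sigma(i)>\sigma(j)>\sigma(k)$ and $l(\sigma)$ its length; $\sigma_{ijk}=0$ if $i,j,k$ are not distinct. $\widetilde{sl_q(n)}$ is the vector space with basis $X^i{}_j$, with coproduct $\Delta X^i{}_j=X^i{}_k\otimes X^k{}_j$, counit $\varepsilon(X^i{}_j)=\delta^i_j$, and braided Lie bracket $$[X^i{}_j,X^k{}_l]=(R^{-1})^a{}_m{}^i{}_b\,R^n{}_c{}^b{}_o\,R^o{}_d{}^c{}_l\,\tilde R^d{}_j{}^k{}_a\;X^m{}_n .$$ It is an object of the braided category of right comodules over the corresponding (multiparameter) $SL(n)$-type quantum group with matrix generators $t^i{}_j$, via $X^i{}_j\mapsto X^a{}_b\otimes S(t^i{}_a)t^b{}_j$; "direct sum in the braided category" means that both summands are subobjects. *)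

theory Defs
  imports
    Complex_Main
    "HOL-Library.Poly_Mapping"
    "HOL-Library.Product_Plus"
    "HOL-Combinatorics.Permutations"
begin

section \<open>Free vector spaces\<close>

text \<open>The type \<open>'b \<Rightarrow>\<^sub>0 'k\<close> is the \<open>k\<close>-vector space with basis \<open>'b\<close>; the library provides
  its addition, but not the scalar multiplication by elements of a field.\<close>

definition smult :: "'k::field \<Rightarrow> ('b \<Rightarrow>\<^sub>0 'k) \<Rightarrow> ('b \<Rightarrow>\<^sub>0 'k)" where
  "smult c x = Poly_Mapping.map ((*) c) x"

lemma lookup_smult [simp]: "Poly_Mapping.lookup (smult c x) b = c * Poly_Mapping.lookup x b"
  unfolding smult_def by transfer (simp add: when_def)

interpretation pm: vector_space "smult :: 'k::field \<Rightarrow> ('b \<Rightarrow>\<^sub>0 'k) \<Rightarrow> ('b \<Rightarrow>\<^sub>0 'k)"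
  by unfold_locales (auto intro!: poly_mapping_eqI simp: lookup_add algebra_simps)


section \<open>R-matrix data\<close>

text \<open>All indices are natural numbers, ranging over \<open>{1..n}\<close>. The number \<open>r i j\<close> is only used
  for \<open>1 \<le> i < j \<le> n\<close>. A matrix with two upper and two lower indices, as in the usual notation
  \<open>R\<^sup>i\<^sub>k\<^sup>j\<^sub>l\<close>, takes its arguments in the order \<open>i k j l\<close>.\<close>

definition delta :: "nat \<Rightarrow> nat \<Rightarrow> 'k::zero_neq_one" where
  "delta i j = (if i = j then 1 else 0)"

definition theta :: "nat \<Rightarrow> nat \<Rightarrow> 'k::zero_neq_one" where
  "theta i j = (if i > j then 1 else 0)"

definition r_params :: "nat \<Rightarrow> 'k::field \<Rightarrow> (nat \<Rightarrow> nat \<Rightarrow> 'k) \<Rightarrow> bool" where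
  "r_params n q r \<longleftrightarrow>
     (\<forall>i\<in>{1..n}. \<forall>j\<in>{1..n}. i < j \<longrightarrow> r i j \<noteq> 0) \<and>
     (\<forall>j\<in>{1..n}. (\<Prod>i\<in>{1..<j}. r i j / q) = (\<Prod>i\<in>{j<..n}. r j i / q))"

definition M_coeff :: "'k::field \<Rightarrow> (nat \<Rightarrow> nat \<Rightarrow> 'k) \<Rightarrow> nat \<Rightarrow> nat \<Rightarrow> 'k" where
  "M_coeff q r i j = q * delta i j + theta j i * (q / r i j) + theta i j * (r j i / q)"

definition L_coeff :: "'k::field \<Rightarrow> nat \<Rightarrow> nat \<Rightarrow> 'k" where
  "L_coeff q i j = theta j i * (q - inverse q)"

definition R_mat :: "'k::field \<Rightarrow> (nat \<Rightarrow> nat \<Rightarrow> 'k) \<Rightarrow> nat \<Rightarrow> nat \<Rightarrow> nat \<Rightarrow> nat \<Rightarrow> 'k" where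
  "R_mat q r i k j l =
     delta i k * delta j l * M_coeff q r i j + delta i l * delta j k * L_coeff q i j"

definition R_inv :: "'k::field \<Rightarrow> (nat \<Rightarrow> nat \<Rightarrow> 'k) \<Rightarrow> nat \<Rightarrow> nat \<Rightarrow> nat \<Rightarrow> nat \<Rightarrow> 'k" where
  "R_inv q r i k j l =
     delta i k * delta j l * inverse (M_coeff q r i j) - delta i l * delta j k * L_coeff q i j"

definition R_tilde :: "'k::field \<Rightarrow> (nat \<Rightarrow> nat \<Rightarrow> 'k) \<Rightarrow> nat \<Rightarrow> nat \<Rightarrow> nat \<Rightarrow> nat \<Rightarrow> 'k" where
  "R_tilde q r i k j l = R_inv q r i k j l * q powi (2 * (int l - int j))"

definition inversions :: "nat set \<Rightarrow> (nat \<Rightarrow> nat) \<Rightarrow> (nat \<times> nat) set" where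
  "inversions A \<sigma> = {(a, b). a \<in> A \<and> b \<in> A \<and> a < b \<and> \<sigma> a > \<sigma> b}"

definition sigma_coeff :: "'k::field \<Rightarrow> (nat \<Rightarrow> nat \<Rightarrow> 'k) \<Rightarrow> nat \<Rightarrow> nat \<Rightarrow> nat \<Rightarrow> 'k" where
  "sigma_coeff q r i j k =
     (if i \<noteq> j \<and> j \<noteq> k \<and> i \<noteq> k then
        let \<sigma> = (THE \<sigma>. \<sigma> permutes {i, j, k} \<and> \<sigma> i > \<sigma> j \<and> \<sigma> j > \<sigma> k)
        in (q * r (\<sigma> k) (\<sigma> i) / (r (\<sigma> j) (\<sigma> i) * r (\<sigma> k) (\<sigma> j)))
             powi ((-1) ^ card (inversions {i, j, k} \<sigma>))
      else 0)"


section \<open>The matrix braided Lie algebra\<close>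

definition X :: "nat \<Rightarrow> nat \<Rightarrow> (nat \<times> nat) \<Rightarrow>\<^sub>0 'k::field" where
  "X i j = Poly_Mapping.single (i, j) 1"

definition sl_tilde :: "nat \<Rightarrow> ((nat \<times> nat) \<Rightarrow>\<^sub>0 'k::field) set" where
  "sl_tilde n = pm.span {X i j | i j. i \<in> {1..n} \<and> j \<in> {1..n}}"

definition counit :: "nat \<Rightarrow> ((nat \<times> nat) \<Rightarrow>\<^sub>0 'k::field) \<Rightarrow> 'k" where
  "counit n x = (\<Sum>i\<in>{1..n}. \<Sum>j\<in>{1..n}. Poly_Mapping.lookup x (i, j) * delta i j)"

definition bracket_gen ::
  "nat \<Rightarrow> 'k::field \<Rightarrow> (nat \<Rightarrow> nat \<Rightarrow> 'k) \<Rightarrow> nat \<Rightarrow> nat \<Rightarrow> nat \<Rightarrow> nat \<Rightarrow> (nat \<times> nat) \<Rightarrow>\<^sub>0 'k" where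
  "bracket_gen n q r i j k l =
     (\<Sum>m\<in>{1..n}. \<Sum>p\<in>{1..n}.
        smult (\<Sum>a\<in>{1..n}. \<Sum>b\<in>{1..n}. \<Sum>c\<in>{1..n}. \<Sum>d\<in>{1..n}. \<Sum>s\<in>{1..n}.
                 R_inv q r a m i b * R_mat q r p c b s * R_mat q r s d c l * R_tilde q r d j k a)
              (X m p))"

definition bracket ::
  "nat \<Rightarrow> 'k::field \<Rightarrow> (nat \<Rightarrow> nat \<Rightarrow> 'k) \<Rightarrow>
    ((nat \<times> nat) \<Rightarrow>\<^sub>0 'k) \<Rightarrow> ((nat \<times> nat) \<Rightarrow>\<^sub>0 'k) \<Rightarrow> ((nat \<times> nat) \<Rightarrow>\<^sub>0 'k)" where
  "bracket n q r x y =
     (\<Sum>i\<in>{1..n}. \<Sum>j\<in>{1..n}. \<Sum>k\<in>{1..n}. \<Sum>l\<in>{1..n}.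
        smult (Poly_Mapping.lookup x (i, j) * Poly_Mapping.lookup y (k, l)) (bracket_gen n q r i j k l))"

definition qtr :: "nat \<Rightarrow> 'k::field \<Rightarrow> (nat \<times> nat) \<Rightarrow>\<^sub>0 'k" where
  "qtr n q = (\<Sum>i\<in>{1..n}. smult (q ^ (2 * i)) (X i i))"

definition sl :: "nat \<Rightarrow> ((nat \<times> nat) \<Rightarrow>\<^sub>0 'k::field) set" where
  "sl n = {x \<in> sl_tilde n. counit n x = 0}"

definition h :: "nat \<Rightarrow> (nat \<times> nat) \<Rightarrow>\<^sub>0 'k::field" where
  "h i = X i i - X (i + 1) (i + 1)"

text \<open>If \<open>q\<^sup>2 = 1\<close>, the value of \<open>qint\<close> is \<open>0\<close> by the convention on division; it is then always
  used with a factor \<open>q - q\<^sup>-\<^sup>1 = 0\<close>.\<close>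

definition qint :: "'k::field \<Rightarrow> nat \<Rightarrow> 'k" where
  "qint q a = (1 - q ^ (2 * a)) / (1 - q ^ 2)"

definition H :: "'k::field \<Rightarrow> nat \<Rightarrow> (nat \<times> nat) \<Rightarrow>\<^sub>0 'k" where
  "H q i = (\<Sum>a\<in>{1..<i}. smult (qint q a) (h a))"

text \<open>The two forms of the non-degeneracy hypothesis. They differ only if \<open>q\<^sup>2 = 1\<close>, when
  \<open>counit n (qtr n q) = of_nat n\<close>.\<close>

lemma counit_qtr: "counit n (qtr n q) = (\<Sum>i\<in>{1..n}. q ^ (2 * i))"
proof -
  have "Poly_Mapping.lookup (qtr n q) (i, j) = q ^ (2 * i) * delta i j" if "i \<in> {1..n}" for i j
  proof -
    have "Poly_Mapping.lookup (qtr n q) (i, j) =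
        (\<Sum>a\<in>{1..n}. Poly_Mapping.lookup (smult (q ^ (2 * a)) (X a a)) (i, j))"
      unfolding qtr_def by (simp add: lookup_sum)
    also have "\<dots> = (\<Sum>a\<in>{1..n}. if a = i then q ^ (2 * i) * delta i j else 0)"
      by (rule sum.cong) (auto simp: X_def lookup_single delta_def when_def)
    finally show ?thesis using that by simp
  qed
  then have "counit n (qtr n q) = (\<Sum>i\<in>{1..n}. \<Sum>j\<in>{1..n}. if j = i then q ^ (2 * i) else 0)"
    unfolding counit_def by (intro sum.cong refl) (simp add: delta_def)
  then show ?thesis by simp
qed

lemma counit_qtr_nonzero_iff:
  fixes q :: "'k::field"
  assumes "q \<noteq> 0" "q ^ 2 \<noteq> 1"
  shows "counit n (qtr n q) \<noteq> 0 \<longleftrightarrow> q ^ (2 * n) \<noteq> 1"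
proof -
  have "(1 - q ^ 2) * (\<Sum>i\<in>{1..n}. q ^ (2 * i)) = q ^ 2 * (1 - q ^ (2 * n))"
  proof (induction n)
    case (Suc n)
    have "(1 - q ^ 2) * (\<Sum>i\<in>{1..Suc n}. q ^ (2 * i)) =
        (1 - q ^ 2) * (\<Sum>i\<in>{1..n}. q ^ (2 * i)) + (1 - q ^ 2) * q ^ (2 * Suc n)"
      by (simp add: distrib_left)
    also have "\<dots> = q ^ 2 * (1 - q ^ (2 * n)) + (1 - q ^ 2) * q ^ (2 * Suc n)"
      by (simp only: Suc)
    also have "\<dots> = q ^ 2 * (1 - q ^ (2 * Suc n))"
      by (simp add: algebra_simps power2_eq_square)
    finally show ?case .
  qed simp
  then show ?thesis unfolding counit_qtr using assms by auto
qed

lemma counit_qtr_nonzero: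
  fixes q :: "'k::field"
  assumes "q \<noteq> 0" "q ^ (2 * n) \<noteq> 1"
  shows "counit n (qtr n q) \<noteq> 0"
proof -
  have "q ^ 2 \<noteq> 1" using assms(2) by (metis power_mult power_one)
  then show ?thesis using assms counit_qtr_nonzero_iff by blast
qed


section \<open>The quantum group\<close>

text \<open>The free algebra on the generators \<open>t\<^sup>i\<^sub>j\<close> is the monoid algebra of the free monoid of words
  in the index pairs \<open>(i, j)\<close>, the multiplication of \<open>'b \<Rightarrow>\<^sub>0 'k\<close> being the convolution product.\<close>

datatype 'g word = Word (letters: "'g list")

instantiation word :: (type) monoid_add
begin
definition zero_word :: "'a word" where "0 = Word []"
definition plus_word :: "'a word \<Rightarrow> 'a word \<Rightarrow> 'a word" where
  "u + v = Word (letters u @ letters v)"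
instance by standard (auto simp: zero_word_def plus_word_def)
end

definition words :: "nat \<Rightarrow> (nat \<times> nat) word set" where
  "words n = {w. set (letters w) \<subseteq> {1..n} \<times> {1..n}}"

definition free_alg :: "nat \<Rightarrow> ((nat \<times> nat) word \<Rightarrow>\<^sub>0 'k::field) set" where
  "free_alg n = {f. Poly_Mapping.keys f \<subseteq> words n}"

definition gen :: "nat \<Rightarrow> nat \<Rightarrow> (nat \<times> nat) word \<Rightarrow>\<^sub>0 'k::field" where
  "gen i j = Poly_Mapping.single (Word [(i, j)]) 1"

text \<open>The relations \<open>R t\<^sub>1 t\<^sub>2 = t\<^sub>2 t\<^sub>1 R\<close>.\<close>

definition frt_rel ::
  "nat \<Rightarrow> 'k::field \<Rightarrow> (nat \<Rightarrow> nat \<Rightarrow> 'k) \<Rightarrow> nat \<Rightarrow> nat \<Rightarrow> nat \<Rightarrow> nat \<Rightarrow> (nat \<times> nat) word \<Rightarrow>\<^sub>0 'k" where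
  "frt_rel n q r i k j l =
     (\<Sum>a\<in>{1..n}. \<Sum>b\<in>{1..n}. smult (R_mat q r i a j b) (gen a k * gen b l))
     - (\<Sum>a\<in>{1..n}. \<Sum>b\<in>{1..n}. smult (R_mat q r a k b l) (gen j b * gen i a))"

text \<open>The coefficients of the quantum determinant are the components \<open>\<epsilon>\<^bsup>\<sigma>(1)\<dots>\<sigma>(n)\<^esup>\<close> of the
  quantum antisymmetric tensor normalised by \<open>\<epsilon>\<^bsup>1\<dots>n\<^esup> = 1\<close>: for this \<open>R\<close>, the tensors on which
  \<open>P R\<close> (with \<open>P\<close> the flip) has eigenvalue \<open>- q\<^sup>-\<^sup>1\<close> in each pair of adjacent places are those with
  \<open>\<epsilon>\<^bsup>\<dots>ji\<dots>\<^esup> = - r\<^sub>i\<^sub>j\<^sup>-\<^sup>1 \<epsilon>\<^bsup>\<dots>ij\<dots>\<^esup>\<close> for \<open>i < j\<close>, and the determinant \<open>D\<close> is given by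
  \<open>t\<^sub>1 \<dots> t\<^sub>n \<epsilon> = D \<epsilon>\<close>. The product condition in \<open>r_params\<close> is what makes \<open>D\<close> central. If
  \<open>r\<^sub>i\<^sub>j = q\<close>, then \<open>D\<close> is the usual determinant, e.g. \<open>t\<^sup>1\<^sub>1 t\<^sup>2\<^sub>2 - q\<^sup>-\<^sup>1 t\<^sup>1\<^sub>2 t\<^sup>2\<^sub>1\<close> for \<open>n = 2\<close>.\<close>

definition qdet :: "nat \<Rightarrow> (nat \<Rightarrow> nat \<Rightarrow> 'k::field) \<Rightarrow> (nat \<times> nat) word \<Rightarrow>\<^sub>0 'k" where
  "qdet n r =
     (\<Sum>\<sigma> | \<sigma> permutes {1..n}.
        smult (\<Prod>(a, b)\<in>inversions {1..n} \<sigma>. - inverse (r (\<sigma> b) (\<sigma> a)))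
              (prod_list (map (\<lambda>a. gen a (\<sigma> a)) [1..<n + 1])))"

definition SL_relations ::
  "nat \<Rightarrow> 'k::field \<Rightarrow> (nat \<Rightarrow> nat \<Rightarrow> 'k) \<Rightarrow> ((nat \<times> nat) word \<Rightarrow>\<^sub>0 'k) set" where
  "SL_relations n q r =
     insert (qdet n r - 1)
       {frt_rel n q r i k j l | i k j l. {i, j, k, l} \<subseteq> {1..n}}"

definition SL_ideal ::
  "nat \<Rightarrow> 'k::field \<Rightarrow> (nat \<Rightarrow> nat \<Rightarrow> 'k) \<Rightarrow> ((nat \<times> nat) word \<Rightarrow>\<^sub>0 'k) set" where
  "SL_ideal n q r =
     pm.span {u * f * v | u f v. u \<in> free_alg n \<and> f \<in> SL_relations n q r \<and> v \<in> free_alg n}"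

text \<open>Coproduct and counit of the free algebra: the algebra maps with
  \<open>t\<^sup>i\<^sub>j \<mapsto> \<Sum>\<^sub>a t\<^sup>i\<^sub>a \<otimes> t\<^sup>a\<^sub>j\<close> and \<open>t\<^sup>i\<^sub>j \<mapsto> \<delta>\<^sup>i\<^sub>j\<close>, here on words. The tensor square of the free algebra
  is the monoid algebra of pairs of words, so the multiplication used in \<open>coprod_word\<close> is
  that of the tensor product algebra.\<close>

definition coprod_word ::
  "nat \<Rightarrow> (nat \<times> nat) word \<Rightarrow> ((nat \<times> nat) word \<times> (nat \<times> nat) word) \<Rightarrow>\<^sub>0 'k::field" where
  "coprod_word n w =
     prod_list (map (\<lambda>(i, j). \<Sum>a\<in>{1..n}. Poly_Mapping.single (Word [(i, a)], Word [(a, j)]) 1)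
       (letters w))"

definition counit_word :: "(nat \<times> nat) word \<Rightarrow> 'k::field" where
  "counit_word w = prod_list (map (\<lambda>(i, j). delta i j) (letters w))"

definition eval_word :: "(nat \<Rightarrow> nat \<Rightarrow> 'a::ring_1) \<Rightarrow> (nat \<times> nat) word \<Rightarrow> 'a" where
  "eval_word t w = prod_list (map (\<lambda>(i, j). t i j) (letters w))"

definition eval_free ::
  "('k::field \<Rightarrow> 'a \<Rightarrow> 'a) \<Rightarrow> (nat \<Rightarrow> nat \<Rightarrow> 'a::ring_1) \<Rightarrow> ((nat \<times> nat) word \<Rightarrow>\<^sub>0 'k) \<Rightarrow> 'a" where
  "eval_free scale t f = (\<Sum>w\<in>Poly_Mapping.keys f. scale (Poly_Mapping.lookup f w) (eval_word t w))"

text \<open>The algebra \<open>'a\<close> with generators \<open>t\<close> is (a copy of) the Hopf algebra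
  \<open>k\<langle>t\<^sup>i\<^sub>j\<rangle> / (R t\<^sub>1 t\<^sub>2 = t\<^sub>2 t\<^sub>1 R, D = 1)\<close>. Its coproduct and counit are induced from the free
  algebra, and \<open>S\<close> is its antipode, i.e. the convolution inverse of the identity; the antipode
  axioms are stated on the words in the generators, which span \<open>'a\<close>.\<close>

locale SL_quantum_group = vector_space scale
  for scale :: "'k::field \<Rightarrow> 'a::ring_1 \<Rightarrow> 'a" +
  fixes n :: nat and q :: 'k and r :: "nat \<Rightarrow> nat \<Rightarrow> 'k"
    and t :: "nat \<Rightarrow> nat \<Rightarrow> 'a" and S :: "'a \<Rightarrow> 'a"
  assumes scale_mult_left: "scale c x * y = scale c (x * y)"
    and scale_mult_right: "x * scale c y = scale c (x * y)"
    and eval_surj: "\<exists>f\<in>free_alg n. eval_free scale t f = x"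
    and eval_kernel: "f \<in> free_alg n \<Longrightarrow> eval_free scale t f = 0 \<longleftrightarrow> f \<in> SL_ideal n q r"
    and antipode_linear: "Vector_Spaces.linear scale scale S"
    and antipode_left: "w \<in> words n \<Longrightarrow>
      (\<Sum>(u, v)\<in>Poly_Mapping.keys (coprod_word n w :: _ \<Rightarrow>\<^sub>0 'k).
         scale (Poly_Mapping.lookup (coprod_word n w) (u, v)) (S (eval_word t u) * eval_word t v))
      = scale (counit_word w) 1"
    and antipode_right: "w \<in> words n \<Longrightarrow>
      (\<Sum>(u, v)\<in>Poly_Mapping.keys (coprod_word n w :: _ \<Rightarrow>\<^sub>0 'k).
         scale (Poly_Mapping.lookup (coprod_word n w) (u, v)) (eval_word t u * S (eval_word t v)))
      = scale (counit_word w) 1"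


section \<open>Direct sums in the category of comodules\<close>

text \<open>For an algebra \<open>'a\<close>, the tensor product of \<open>(nat \<times> nat) \<Rightarrow>\<^sub>0 'k\<close> with \<open>'a\<close> is realised as
  \<open>(nat \<times> nat) \<Rightarrow>\<^sub>0 'a\<close>, in which \<open>X a b \<otimes> x\<close> is \<open>Poly_Mapping.single (a, b) x\<close>.\<close>

definition pure_tensor ::
  "('k::field \<Rightarrow> 'a \<Rightarrow> 'a) \<Rightarrow> ((nat \<times> nat) \<Rightarrow>\<^sub>0 'k) \<Rightarrow> 'a \<Rightarrow> ((nat \<times> nat) \<Rightarrow>\<^sub>0 'a::ring_1)" where
  "pure_tensor scale x a = Poly_Mapping.map (\<lambda>c. scale c a) x"

definition tensor_with ::
  "('k::field \<Rightarrow> 'a \<Rightarrow> 'a) \<Rightarrow> ((nat \<times> nat) \<Rightarrow>\<^sub>0 'k) set \<Rightarrow> ((nat \<times> nat) \<Rightarrow>\<^sub>0 'a::ring_1) set" where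
  "tensor_with scale W =
     {(\<Sum>i<m. pure_tensor scale (w i) (a i)) | (m :: nat) w a. \<forall>i<m. w i \<in> W}"

text \<open>The linear extension of \<open>X\<^sup>i\<^sub>j \<mapsto> \<Sum>\<^sub>a\<^sub>b X\<^sup>a\<^sub>b \<otimes> S(t\<^sup>i\<^sub>a) t\<^sup>b\<^sub>j\<close>.\<close>

definition coaction ::
  "('k::field \<Rightarrow> 'a \<Rightarrow> 'a) \<Rightarrow> nat \<Rightarrow> (nat \<Rightarrow> nat \<Rightarrow> 'a) \<Rightarrow> ('a \<Rightarrow> 'a) \<Rightarrow>
    ((nat \<times> nat) \<Rightarrow>\<^sub>0 'k) \<Rightarrow> ((nat \<times> nat) \<Rightarrow>\<^sub>0 'a::ring_1)" where
  "coaction scale n t S x =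
     (\<Sum>i\<in>{1..n}. \<Sum>j\<in>{1..n}. \<Sum>a\<in>{1..n}. \<Sum>b\<in>{1..n}.
        pure_tensor scale (smult (Poly_Mapping.lookup x (i, j)) (X a b)) (S (t i a) * t b j))"

definition subcomodule ::
  "('k::field \<Rightarrow> 'a \<Rightarrow> 'a) \<Rightarrow> nat \<Rightarrow> (nat \<Rightarrow> nat \<Rightarrow> 'a) \<Rightarrow> ('a \<Rightarrow> 'a::ring_1) \<Rightarrow>
    ((nat \<times> nat) \<Rightarrow>\<^sub>0 'k) set \<Rightarrow> bool" where
  "subcomodule scale n t S W \<longleftrightarrow>
     pm.subspace W \<and> W \<subseteq> sl_tilde n \<and> (\<forall>x\<in>W. coaction scale n t S x \<in> tensor_with scale W)"

definition is_direct_sum ::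
  "('b \<Rightarrow>\<^sub>0 'k::field) set \<Rightarrow> ('b \<Rightarrow>\<^sub>0 'k) set \<Rightarrow> ('b \<Rightarrow>\<^sub>0 'k) set \<Rightarrow> bool" where
  "is_direct_sum V U W \<longleftrightarrow>
     pm.subspace U \<and> pm.subspace W \<and> V = {u + w | u w. u \<in> U \<and> w \<in> W} \<and> U \<inter> W = {0}"

end

theory Submission
  imports Defs
begin

text \<open>
  Each R-matrix is a diagonal matrix plus a flip with coefficients, so that the fivefold sum defining
  the structure constants of the bracket collapses to four terms, with a single remaining sum
  \<open>\<Sum>\<^sub>a q\<^sup>2\<^sup>a (R\<^sub>2\<^sub>1 R)\<close> that is a geometric series with a jump. This gives closed formulas for the
  brackets of basis elements, and from them \<open>[x, tr] = \<epsilon>(x) tr\<close> and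
  \<open>[tr, x] = (1 + \<mu>\<^sup>2) \<epsilon>(tr) x - \<mu>\<^sup>2 \<epsilon>(x) tr\<close> for all \<open>x\<close>.

  For the coaction, conjugating \<open>R t\<^sub>1 t\<^sub>2 = t\<^sub>2 t\<^sub>1 R\<close> with \<open>S(t\<^sub>2)\<close> exchanges the order of \<open>S(t)\<close> and \<open>t\<close>;
  the weighted trace of the result and a descending induction yield
  \<open>\<Sum>\<^sub>k q\<^sup>2\<^sup>k S(t\<^sup>k\<^sub>s) t\<^sup>i\<^sub>k = q\<^sup>2\<^sup>i \<delta>\<^sup>i\<^sub>s\<close>, which says that \<open>tr\<close> is coinvariant. The kernel of the
  counit is a subcomodule because of \<open>\<Sum>\<^sub>a S(t\<^sup>i\<^sub>a) t\<^sup>a\<^sub>j = \<delta>\<^sup>i\<^sub>j\<close>.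
\<close>

section \<open>Structure constants\<close>

lemma sum_delta2:
  assumes "finite A" "finite B" "a \<in> A" "b \<in> B"
  shows "(\<Sum>x\<in>A. \<Sum>y\<in>B. if x = a then if y = b then c else 0 else (0::'a::comm_monoid_add)) = c"
proof -
  have "(\<Sum>y\<in>B. if x = a then if y = b then c else 0 else 0) = (if x = a then c else 0)" for x
    using assms by simp
  then show ?thesis
    using assms by simp
qed

locale R_matrix_data =
  fixes n :: nat and q :: "'k::field" and r :: "nat \<Rightarrow> nat \<Rightarrow> 'k"
  assumes q_nonzero [simp]: "q \<noteq> 0"
    and r_nonzero: "\<lbrakk>i \<in> {1..n}; j \<in> {1..n}; i < j\<rbrakk> \<Longrightarrow> r i j \<noteq> 0"
begin

definition mu :: 'k where "mu = q - inverse q"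
abbreviation w :: "nat \<Rightarrow> 'k" where "w a \<equiv> q ^ (2 * a)"
abbreviation M where "M \<equiv> M_coeff q r"
abbreviation L where "L \<equiv> L_coeff q"

lemma mu_times_q: "mu * q = q\<^sup>2 - 1"
  by (simp add: mu_def left_diff_distrib power2_eq_square)

lemma M_diag [simp]: "M i i = q"
  by (simp add: M_coeff_def delta_def theta_def)

lemma M_less: "i < j \<Longrightarrow> M i j = q / r i j"
  by (simp add: M_coeff_def delta_def theta_def)

lemma M_greater: "j < i \<Longrightarrow> M i j = r j i / q"
  by (simp add: M_coeff_def delta_def theta_def)

lemma M_nonzero: "\<lbrakk>i \<in> {1..n}; j \<in> {1..n}\<rbrakk> \<Longrightarrow> M i j \<noteq> 0"
  by (cases i j rule: linorder_cases) (auto simp: M_less M_greater r_nonzero)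

text \<open>Off the diagonal the two weights are \<open>q / r i j\<close> and its reciprocal. This
  is how the parameters \<open>r\<close> drop out of \<open>u\<close> and of the brackets of
  \<open>X i i\<close> with other diagonal elements.\<close>

lemma M_swap: "\<lbrakk>i \<in> {1..n}; j \<in> {1..n}; i \<noteq> j\<rbrakk> \<Longrightarrow> M i j * M j i = 1"
  using r_nonzero[of i j] r_nonzero[of j i]
  by (cases i j rule: linorder_cases) (auto simp: M_less M_greater)

lemma L_eq: "L i j = (if i < j then mu else 0)"
  by (simp add: L_coeff_def theta_def mu_def)

text \<open>The diagonal entry \<open>M\<^sub>a\<^sub>l M\<^sub>l\<^sub>a + L\<^sub>l\<^sub>a\<^sup>2\<close> of \<open>R\<^sub>2\<^sub>1 R\<close>.\<close>

definition u :: "nat \<Rightarrow> nat \<Rightarrow> 'k" where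
  "u l a = (if a = l then q\<^sup>2 else if a < l then 1 else 1 + mu\<^sup>2)"

text \<open>The sum telescopes, because \<open>mu * w a\<close> is the difference of
  \<open>w (a + 1) / q\<close> and \<open>w a / q\<close>. When \<open>a\<close> passes
  \<open>l\<close>, the term \<open>u l l = q^2\<close> is exactly what raises the factor from
  \<open>1\<close> to \<open>1 + mu^2\<close>. The summand \<open>- q\<close> is the lower end
  \<open>w 1 / q\<close>.\<close>

lemma geometric_u:
  assumes "m \<ge> 1" "l \<ge> 1"
  shows "mu * (\<Sum>a\<in>{1..<m}. w a * u l a) = w m / q * (if m \<le> l then 1 else 1 + mu\<^sup>2) - q"
  using assms(1)
proof (induction m rule: dec_induct)
  case base
  show ?case
    using assms(2) by (simp add: mu_def power2_eq_square)
next
  case (step m)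
  define v where "v m = (if m \<le> l then 1 else 1 + mu\<^sup>2)" for m
  \<comment> \<open>With a name for the inverse, the identities below follow from the polynomial
    relation \<open>q * p = 1\<close>, which \<open>algebra\<close> can exploit.\<close>
  obtain p where p: "inverse q = p" "q * p = 1"
    by simp
  have "q * v m / q + q * mu * u l m = q * q * v (Suc m)"
  proof (cases m l rule: linorder_cases)
    case less
    then show ?thesis by (simp add: v_def u_def right_diff_distrib mu_def power2_eq_square)
  next
    case equal
    have "1 + q * (q - p) * (q * q) = q * q * (1 + (q - p) * (q - p))"
      using p(2) by algebra
    with equal show ?thesis by (simp add: v_def u_def mu_def power2_eq_square p(1))
  next
    case greater
    have "1 + (q - p) * (q - p) + q * (q - p) * (1 + (q - p) * (q - p)) = q * q * (1 + (q - p) * (q - p))"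
      using p(2) by algebra
    with greater show ?thesis by (simp add: v_def u_def mu_def power2_eq_square p(1))
  qed
  moreover have "v m / q + mu * u l m = (q * v m / q + q * mu * u l m) / q"
    by (simp add: add_divide_distrib)
  ultimately have *: "v m / q + mu * u l m = q * v (Suc m)"
    by simp
  have "mu * (\<Sum>a\<in>{1..<Suc m}. w a * u l a) = w m * (v m / q + mu * u l m) - q"
    using step by (simp add: v_def distrib_left)
  also have "\<dots> = w (Suc m) / q * v (Suc m) - q"
    unfolding * by (simp add: power2_eq_square)
  finally show ?case
    by (simp add: v_def)
qed

lemma sum_R_mat:
  assumes "p \<in> {1..n}" "b \<in> {1..n}"
  shows "(\<Sum>c\<in>{1..n}. \<Sum>s\<in>{1..n}. R_mat q r p c b s * F c s) = M p b * F p b + L p b * F b p"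
proof -
  have "R_mat q r p c b s * F c s =
      (if c = p then if s = b then M p b * F p b else 0 else 0) +
      (if c = b then if s = p then L p b * F b p else 0 else 0)" for c s
    by (auto simp: R_mat_def delta_def L_eq)
  then show ?thesis
    using assms by (simp add: sum.distrib sum_delta2)
qed

lemma sum_R_inv:
  assumes "i \<in> {1..n}" "a \<in> {1..n}"
  shows "(\<Sum>b\<in>{1..n}. R_inv q r a m i b * F b) =
    delta a m * (F i / M a i) - delta i m * (L a i * F a)"
proof -
  have "R_inv q r a m i b * F b =
      (if b = i then delta a m * (F i / M a i) else 0) -
      (if b = a then delta i m * (L a i * F a) else 0)" for b
    by (auto simp: R_inv_def delta_def divide_inverse L_eq)
  then show ?thesis
    using assms by (simp add: sum_subtractf)
qed

text \<open>On the diagonal part \<open>k = a\<close>, so the extra power of \<open>q\<close> is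
  \<open>1\<close> there; only the flip part carries the quotient \<open>w a / w k\<close>.\<close>

lemma R_tilde_eq:
  "R_tilde q r d j k a = delta d j * delta k a / M d k - delta d a * delta j k * (L d k * (w a / w k))"
proof -
  have "q powi (2 * (int a - int k)) = w a / w k"
    using power_int_of_nat[of q "2 * a"] power_int_of_nat[of q "2 * k"]
    by (simp add: right_diff_distrib power_int_diff)
  then show ?thesis
    by (simp add: R_tilde_def R_inv_def delta_def divide_inverse)
qed

text \<open>The entries of the product of the two middle R-matrices, computed in
  \<open>sum_R_R\<close>. For \<open>p \<noteq> b\<close> exactly one of \<open>L p b\<close> and
  \<open>L b p\<close> is \<open>mu\<close>, and for \<open>p = b\<close> both vanish, which
  explains the conditional.\<close>

definition Q :: "nat \<Rightarrow> nat \<Rightarrow> nat \<Rightarrow> nat \<Rightarrow> 'k" where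
  "Q p b d l = delta b d * delta p l * u p b + delta b l * delta p d * (if p = b then 0 else mu * M p b)"

lemma sum_R_R:
  assumes "p \<in> {1..n}" "b \<in> {1..n}"
  shows "(\<Sum>c\<in>{1..n}. \<Sum>s\<in>{1..n}. R_mat q r p c b s * R_mat q r s d c l) = Q p b d l"
proof -
  have "(\<Sum>c\<in>{1..n}. \<Sum>s\<in>{1..n}. R_mat q r p c b s * R_mat q r s d c l) =
      M p b * R_mat q r b d p l + L p b * R_mat q r p d b l"
    by (rule sum_R_mat[OF assms])
  also have "\<dots> = delta b d * delta p l * (M p b * M b p + L p b * L p b) +
      delta b l * delta p d * (M p b * (L b p + L p b))"
    by (simp add: R_mat_def algebra_simps delta_def)
  also have "\<dots> = Q p b d l"
  proof (cases "p = b")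
    case True
    then show ?thesis by (simp add: Q_def u_def L_eq power2_eq_square)
  next
    case False
    then have "M p b * M b p = 1"
      using assms by (rule_tac M_swap)
    then show ?thesis
      using False by (auto simp: Q_def u_def L_eq power2_eq_square)
  qed
  finally show ?thesis .
qed

text \<open>The four terms come from choosing the diagonal or the flip part in \<open>R_inv\<close>
  and in \<open>R_tilde\<close>. If both are flips, the index \<open>a\<close> stays free, and the
  factors \<open>L a i\<close> and \<open>L a k\<close> restrict it to
  \<open>a < min i k\<close>.\<close>

definition bracket_coeff :: "nat \<Rightarrow> nat \<Rightarrow> nat \<Rightarrow> nat \<Rightarrow> nat \<Rightarrow> nat \<Rightarrow> 'k" where
  "bracket_coeff i j k l m p =
     delta k m * Q p i j l / (M k i * M j k) - delta j k * L m k * (w m / w k) * Q p i m l / M m i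
     - delta i m * L k i * Q p k j l / M j k
     + delta i m * delta j k * delta p l * (\<Sum>a\<in>{1..<min i k}. mu\<^sup>2 * (w a / w k) * u p a)"

text \<open>The sums over \<open>c\<close> and \<open>s\<close> contract the two middle matrices to
  \<open>Q\<close>; then \<open>d\<close> is contracted against \<open>R_tilde\<close>, and finally
  \<open>b\<close> and \<open>a\<close> against \<open>R_inv\<close>.\<close>

lemma sum_bracket_coeff:
  assumes "i \<in> {1..n}" "j \<in> {1..n}" "k \<in> {1..n}" "l \<in> {1..n}" "m \<in> {1..n}" "p \<in> {1..n}"
  shows "(\<Sum>a\<in>{1..n}. \<Sum>b\<in>{1..n}. \<Sum>c\<in>{1..n}. \<Sum>d\<in>{1..n}. \<Sum>s\<in>{1..n}.
      R_inv q r a m i b * R_mat q r p c b s * R_mat q r s d c l * R_tilde q r d j k a) =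
    bracket_coeff i j k l m p"
proof -
  have sum_d: "(\<Sum>d\<in>{1..n}. Q p b d l * R_tilde q r d j k a) =
      delta k a * Q p b j l / M j k - delta j k * L a k * (w a / w k) * Q p b a l"
    if "a \<in> {1..n}" for a b
  proof -
    have "Q p b d l * R_tilde q r d j k a =
      (if d = j then delta k a * Q p b j l / M j k else 0) -
      (if d = a then delta j k * L a k * (w a / w k) * Q p b a l else 0)" for d
      by (auto simp: R_tilde_eq delta_def L_eq)
    then show ?thesis
      using assms that by (simp add: sum_subtractf)
  qed
  have "(\<Sum>c\<in>{1..n}. \<Sum>d\<in>{1..n}. \<Sum>s\<in>{1..n}.
      R_inv q r a m i b * R_mat q r p c b s * R_mat q r s d c l * R_tilde q r d j k a) =
    R_inv q r a m i b * (\<Sum>d\<in>{1..n}. Q p b d l * R_tilde q r d j k a)"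
    if "b \<in> {1..n}" for a b
  proof -
    have "(\<Sum>c\<in>{1..n}. \<Sum>d\<in>{1..n}. \<Sum>s\<in>{1..n}.
        R_inv q r a m i b * R_mat q r p c b s * R_mat q r s d c l * R_tilde q r d j k a) =
      (\<Sum>d\<in>{1..n}. \<Sum>c\<in>{1..n}. \<Sum>s\<in>{1..n}.
        R_inv q r a m i b * R_mat q r p c b s * R_mat q r s d c l * R_tilde q r d j k a)"
      by (rule sum.swap)
    then show ?thesis
      unfolding sum_R_R[OF assms(6) that, symmetric]
      by (simp add: sum_distrib_left sum_distrib_right mult.assoc)
  qed
  then have "(\<Sum>a\<in>{1..n}. \<Sum>b\<in>{1..n}. \<Sum>c\<in>{1..n}. \<Sum>d\<in>{1..n}. \<Sum>s\<in>{1..n}.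
      R_inv q r a m i b * R_mat q r p c b s * R_mat q r s d c l * R_tilde q r d j k a) =
    (\<Sum>a\<in>{1..n}. \<Sum>b\<in>{1..n}. R_inv q r a m i b * (\<Sum>d\<in>{1..n}. Q p b d l * R_tilde q r d j k a))"
    by simp
  also have "\<dots> = (\<Sum>a\<in>{1..n}. delta a m * ((\<Sum>d\<in>{1..n}. Q p i d l * R_tilde q r d j k a) / M a i)
      - delta i m * (L a i * (\<Sum>d\<in>{1..n}. Q p a d l * R_tilde q r d j k a)))"
    using assms by (simp add: sum_R_inv del: One_nat_def)
  also have "\<dots> = (\<Sum>d\<in>{1..n}. Q p i d l * R_tilde q r d j k m) / M m i
      - delta i m * (\<Sum>a\<in>{1..n}. L a i * (\<Sum>d\<in>{1..n}. Q p a d l * R_tilde q r d j k a))"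
  proof -
    have "delta a m * g a = (if a = m then g m else 0)" for a and g :: "nat \<Rightarrow> 'k"
      by (simp add: delta_def)
    then have "(\<Sum>a\<in>{1..n}. delta a m * g a) = g m" for g :: "nat \<Rightarrow> 'k"
      using assms by simp
    then show ?thesis
      by (simp only: sum_subtractf sum_distrib_left[symmetric])
  qed
  also have "(\<Sum>d\<in>{1..n}. Q p i d l * R_tilde q r d j k m) / M m i =
      delta k m * Q p i j l / (M k i * M j k) - delta j k * L m k * (w m / w k) * Q p i m l / M m i"
    unfolding sum_d[OF assms(5)] by (simp add: diff_divide_distrib delta_def)
  also have "(\<Sum>a\<in>{1..n}. L a i * (\<Sum>d\<in>{1..n}. Q p a d l * R_tilde q r d j k a)) =
      L k i * Q p k j l / M j k
      - delta j k * delta p l * (\<Sum>a\<in>{1..<min i k}. mu\<^sup>2 * (w a / w k) * u p a)"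
  proof -
    have "L a i * (\<Sum>d\<in>{1..n}. Q p a d l * R_tilde q r d j k a) =
        (if a = k then L k i * Q p k j l / M j k else 0) -
        (if a \<in> {1..<min i k} then delta j k * delta p l * (mu\<^sup>2 * (w a / w k) * u p a) else 0)"
      if "a \<in> {1..n}" for a
    proof -
      \<comment> \<open>The second term of \<open>Q\<close> would require \<open>p = a\<close> here,
        and then its coefficient is \<open>0\<close>.\<close>
      have "Q p a a l = delta p l * u p a"
        by (auto simp: Q_def delta_def)
      then show ?thesis
        unfolding sum_d[OF that] using that
        by (auto simp: L_eq delta_def right_diff_distrib power2_eq_square)
    qed
    then have "(\<Sum>a\<in>{1..n}. L a i * (\<Sum>d\<in>{1..n}. Q p a d l * R_tilde q r d j k a)) =
        (\<Sum>a\<in>{1..n}. if a = k then L k i * Q p k j l / M j k else 0) -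
        (\<Sum>a\<in>{1..n}. if a \<in> {1..<min i k} then delta j k * delta p l * (mu\<^sup>2 * (w a / w k) * u p a) else 0)"
      by (simp only: flip: sum_subtractf cong: sum.cong)
    also have "(\<Sum>a\<in>{1..n}. if a = k then L k i * Q p k j l / M j k else 0) = L k i * Q p k j l / M j k"
      using assms by simp
    also have "(\<Sum>a\<in>{1..n}. if a \<in> {1..<min i k} then delta j k * delta p l * (mu\<^sup>2 * (w a / w k) * u p a) else 0) =
        (\<Sum>a\<in>{1..<min i k}. delta j k * delta p l * (mu\<^sup>2 * (w a / w k) * u p a))"
      using assms by (intro sum.mono_neutral_cong_right) auto
    finally show ?thesis
      by (simp only: sum_distrib_left)
  qed
  finally show ?thesis
    by (simp add: bracket_coeff_def right_diff_distrib mult.assoc)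
qed

lemma lookup_bracket_gen:
  assumes "i \<in> {1..n}" "j \<in> {1..n}" "k \<in> {1..n}" "l \<in> {1..n}"
  shows "Poly_Mapping.lookup (bracket_gen n q r i j k l) (m, p) =
    (if m \<in> {1..n} \<and> p \<in> {1..n} then bracket_coeff i j k l m p else 0)"
proof -
  have "Poly_Mapping.lookup (bracket_gen n q r i j k l) (m, p) =
    (\<Sum>m'\<in>{1..n}. \<Sum>p'\<in>{1..n}. bracket_coeff i j k l m' p' * Poly_Mapping.lookup (X m' p') (m, p))"
    unfolding bracket_gen_def using assms
    by (simp add: lookup_sum sum_bracket_coeff del: One_nat_def)
  also have "\<dots> = (if m \<in> {1..n} \<and> p \<in> {1..n} then bracket_coeff i j k l m p else 0)"
  proof -
    have *: "c m' p' * Poly_Mapping.lookup (X m' p') (m, p) =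
        (if m' = m then if p' = p then c m p else 0 else 0)" for m' p' and c :: "nat \<Rightarrow> nat \<Rightarrow> 'k"
      by (simp add: X_def lookup_single when_def)
    show ?thesis
    proof (cases "m \<in> {1..n} \<and> p \<in> {1..n}")
      case True
      then show ?thesis unfolding * by (simp add: sum_delta2)
    next
      case False
      then show ?thesis unfolding * by (auto intro!: sum.neutral)
    qed
  qed
  finally show ?thesis .
qed

end

lemma lookup_X: "Poly_Mapping.lookup (X i j) (m, p) = (if m = i \<and> p = j then 1 else 0)"
  by (auto simp: X_def lookup_single when_def)

section \<open>Brackets of basis elements of which at least one is diagonal\<close>

context R_matrix_data
begin

lemma w_nonzero: "w a \<noteq> 0"
  by simp

lemma sum_u:
  assumes "m \<ge> 1" "l \<ge> 1"
  shows "(\<Sum>a\<in>{1..<m}. mu\<^sup>2 * (w a / w k) * u l a) =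
    mu / w k * (w m / q * (if m \<le> l then 1 else 1 + mu\<^sup>2) - q)"
  unfolding geometric_u[OF assms, symmetric]
  by (simp add: sum_distrib_left sum_divide_distrib power2_eq_square mult_ac)

text \<open>The coefficient of \<open>X k k\<close> is \<open>u k i\<close>, which exceeds
  \<open>1\<close> by \<open>mu^2\<close> if \<open>k < i\<close>. In that case the flip in
  \<open>R_inv\<close> also contributes \<open>- mu^2\<close> at \<open>X i i\<close>.\<close>

lemma bracket_gen_diag_diag:
  assumes "i \<in> {1..n}" "k \<in> {1..n}" "i \<noteq> k"
  shows "bracket_gen n q r i i k k = X k k + (if k < i then smult (mu\<^sup>2) (X k k - X i i) else 0)"
proof (rule poly_mapping_eqI, clarify)
  fix m p
  have M: "M k i * M i k = 1" "M i k \<noteq> 0"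
    using M_swap[of k i] M_nonzero[of i k] assms by auto
  have "bracket_coeff i i k k m p = delta k m * (delta k p * u k i) - delta i m * delta p i * (if k < i then mu\<^sup>2 else 0)"
    using M assms(3)
    by (auto simp: bracket_coeff_def Q_def L_eq delta_def power2_eq_square)
  then show "Poly_Mapping.lookup (bracket_gen n q r i i k k) (m, p) =
     Poly_Mapping.lookup (X k k + (if k < i then smult (mu\<^sup>2) (X k k - X i i) else 0)) (m, p)"
    using assms
    by (auto simp: lookup_bracket_gen lookup_add lookup_minus lookup_X u_def delta_def)
qed

text \<open>For \<open>q\<^sup>2 \<noteq> 1\<close> this is \<open>q\<^sup>2 H\<^sub>i\<close>, with the \<open>q\<close>-integers written as sums, which avoids dividing by \<open>1 - q\<^sup>2\<close>.\<close>

definition K :: "nat \<Rightarrow> (nat \<times> nat) \<Rightarrow>\<^sub>0 'k" where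
  "K i = (\<Sum>a\<in>{1..<i}. smult (w a) (X a a - X i i))"

lemma lookup_K:
  "Poly_Mapping.lookup (K i) (m, p) =
    (if m = p \<and> m \<in> {1..<i} then w m else 0) - (if m = i \<and> p = i then \<Sum>a\<in>{1..<i}. w a else 0)"
proof -
  have "Poly_Mapping.lookup (K i) (m, p) =
      (\<Sum>a\<in>{1..<i}. (if a = m then if m = p then w m else 0 else 0) - (if m = i \<and> p = i then w a else 0))"
    unfolding K_def lookup_sum
    by (intro sum.cong refl) (auto simp: lookup_minus lookup_X)
  then show ?thesis
    by (auto simp: sum_subtractf)
qed

text \<open>The flip in \<open>R_tilde\<close> reaches every \<open>X m m\<close> with
  \<open>m < i\<close>, while the double flip has \<open>u i a = 1\<close> throughout and adds the
  sum of these weights at \<open>X i i\<close>. Together they form a multiple of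
  \<open>K i\<close>.\<close>

lemma bracket_gen_diag_same:
  assumes "i \<in> {1..n}"
  shows "bracket_gen n q r i i i i = X i i - smult (mu\<^sup>2 / w i) (K i)"
proof (rule poly_mapping_eqI, clarify)
  fix m p
  have "M m i \<noteq> 0" if "m \<in> {1..n}"
    using M_nonzero that assms by auto
  moreover have "(\<Sum>a\<in>{1..<i}. mu\<^sup>2 * (w a / w i) * u i a) = mu\<^sup>2 / w i * (\<Sum>a\<in>{1..<i}. w a)"
    by (simp add: u_def sum_distrib_left)
  ultimately have "bracket_coeff i i i i m p =
      delta i m * delta p i * (1 + mu\<^sup>2 / w i * (\<Sum>a\<in>{1..<i}. w a))
      - delta m p * (if m < i then mu\<^sup>2 * (w m / w i) else 0)" if "m \<in> {1..n}"
    using that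
    by (auto simp: bracket_coeff_def Q_def L_eq delta_def power2_eq_square u_def)
  then show "Poly_Mapping.lookup (bracket_gen n q r i i i i) (m, p) =
     Poly_Mapping.lookup (X i i - smult (mu\<^sup>2 / w i) (K i)) (m, p)"
    using assms
    by (auto simp: lookup_bracket_gen lookup_minus lookup_X lookup_K delta_def)
qed

text \<open>For \<open>i \<noteq> k\<close> only the first term of \<open>bracket_coeff\<close>
  survives and gives the scalar \<open>u l i\<close>. For \<open>i = k\<close> the geometric sum
  joins it, and the two add up because \<open>1 / q^2 + mu / q = 1\<close>.\<close>

lemma bracket_gen_diag_left:
  assumes "i \<in> {1..n}" "k \<in> {1..n}" "l \<in> {1..n}" "k \<noteq> l"
  shows "bracket_gen n q r i i k l =
    smult (1 + (if i = l then mu * q else if l < i then mu\<^sup>2 else 0) - (if i = k then mu * q / w k else 0)) (X k l)"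
    (is "_ = smult ?c _")
proof (rule poly_mapping_eqI, clarify)
  fix m p
  have "bracket_coeff i i k l m p = ?c * delta m k * delta p l"
  proof (cases "i = k")
    case True
    have "bracket_coeff i i k l m p =
        delta m k * delta p l * (u l k / q\<^sup>2 + (\<Sum>a\<in>{1..<k}. mu\<^sup>2 * (w a / w k) * u l a))"
      using assms True
      by (auto simp: bracket_coeff_def Q_def L_eq delta_def power2_eq_square)
    also have "u l k / q\<^sup>2 + (\<Sum>a\<in>{1..<k}. mu\<^sup>2 * (w a / w k) * u l a) =
        u l k * (1 / q\<^sup>2 + mu / q) - mu * q / w k"
    proof -
      define v where "v = (if k \<le> l then 1 else 1 + mu\<^sup>2)"
      have sum: "(\<Sum>a\<in>{1..<k}. mu\<^sup>2 * (w a / w k) * u l a) = mu / w k * (w k / q * v - q)"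
        unfolding v_def using assms by (intro sum_u) auto
      \<comment> \<open>Since \<open>k \<noteq> l\<close>, the exceptional value \<open>q^2\<close>
        of \<open>u\<close> does not occur, so \<open>u l k\<close> equals the jump factor of the
        geometric sum.\<close>
      have u: "u l k = v"
        using assms by (simp add: u_def v_def)
      have "mu / w k * (w k / q * v - q) = mu / q * v - mu * q / w k"
        using w_nonzero[of k] by (simp add: right_diff_distrib)
      then show ?thesis
        unfolding sum u by (simp add: distrib_left)
    qed
    also have "1 / q\<^sup>2 + mu / q = 1"
      by (simp add: mu_def power2_eq_square field_simps)
    finally show ?thesis
      using True assms by (auto simp: u_def)
  next
    case False
    then have "M k i * M i k = 1"
      using M_swap[of k i] assms by auto
    then have "bracket_coeff i i k l m p = delta m k * delta p l * u l i"
      using assms False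
      by (auto simp: bracket_coeff_def Q_def L_eq delta_def)
    then show ?thesis
      using False by (auto simp: u_def mu_times_q)
  qed
  then show "Poly_Mapping.lookup (bracket_gen n q r i i k l) (m, p) = Poly_Mapping.lookup (smult ?c (X k l)) (m, p)"
    using assms by (auto simp: lookup_bracket_gen lookup_X delta_def)
qed

text \<open>The delicate case is \<open>k = j\<close>, where the geometric sum ends at
  \<open>min i j\<close>. For \<open>i < j\<close> its upper end cancels the flip term in
  \<open>R_tilde\<close>; for \<open>j < i\<close> it combines with the flip term in
  \<open>R_inv\<close> to \<open>- mu^2\<close>. The lower end gives \<open>- mu * q / w j\<close>
  both times.\<close>

lemma bracket_gen_diag_right:
  assumes "i \<in> {1..n}" "j \<in> {1..n}" "k \<in> {1..n}" "i \<noteq> j"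
  shows "bracket_gen n q r i j k k =
    smult (mu * ((if k = i then inverse q else 0) - (if k = j then q / w j else 0) - (if k < i then mu else 0))) (X i j)"
    (is "_ = smult ?c _")
proof (rule poly_mapping_eqI, clarify)
  fix m p
  have "M i j \<noteq> 0" "M j i \<noteq> 0" "M j k \<noteq> 0"
    using M_nonzero assms by auto
  then have "bracket_coeff i j k k m p = delta m i * delta p j *
      ((if k = i then mu / q else 0) - (if k = j \<and> i < j then mu * w i / w k / q else 0)
      - (if k < i then if k = j then mu * q else mu\<^sup>2 else 0)
      + (if k = j then \<Sum>a\<in>{1..<min i j}. mu\<^sup>2 * (w a / w k) * u j a else 0))"
    using assms
    by (auto simp: bracket_coeff_def Q_def L_eq delta_def u_def power2_eq_square)
  also have "\<dots> = ?c * delta m i * delta p j"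
  proof -
    have sum: "(\<Sum>a\<in>{1..<min i j}. mu\<^sup>2 * (w a / w k) * u j a) = mu / w k * (w (min i j) / q - q)"
      using sum_u[of "min i j" j k] assms by simp
    consider "k = i" | "k = j" "i < j" | "k = j" "j < i" | "k \<noteq> i" "k \<noteq> j"
      using assms(4) by linarith
    then show ?thesis
    proof cases
      case 3
      have "mu / w j * (w j / q - q) - mu * q = mu * (- (q / w j) - (q - 1 / q))"
        using w_nonzero[of j] by (simp add: right_diff_distrib)
      then have "- (mu * q) + mu / w j * (w j / q - q) = mu * (- (q / w j) - mu)"
        by (simp add: mu_def divide_inverse)
      with 3 show ?thesis
        unfolding sum by (simp add: mult_ac)
    next
      case 2
      have "- (mu * w i / w j / q) + mu / w j * (w i / q - q) = - (mu * (q / w j))"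
        by (simp add: algebra_simps divide_inverse)
      with 2 show ?thesis
        unfolding sum by (simp add: mult_ac)
    qed (use assms(4) in \<open>simp_all add: divide_inverse power2_eq_square\<close>)
  qed
  finally have "bracket_coeff i j k k m p = ?c * delta m i * delta p j" .
  then show "Poly_Mapping.lookup (bracket_gen n q r i j k k) (m, p) = Poly_Mapping.lookup (smult ?c (X i j)) (m, p)"
    using assms by (auto simp: lookup_bracket_gen lookup_X delta_def)
qed

end

section \<open>The coefficients \<open>\<sigma>\<^sub>i\<^sub>j\<^sub>k\<close>\<close>

text \<open>If \<open>x > y > z\<close> lists \<open>{i, j, k}\<close> in decreasing order, the
  permutation in the definition can only be \<open>i \<mapsto> x\<close>,
  \<open>j \<mapsto> y\<close>, \<open>k \<mapsto> z\<close>.\<close>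

lemma sigma_coeff_eq:
  assumes xyz: "{i, j, k} = {x, y, z}" "z < y" "y < x"
    and distinct: "i \<noteq> j" "j \<noteq> k" "i \<noteq> k"
  shows "sigma_coeff q r i j k =
    (q * r z x / (r y x * r z y)) powi ((-1) ^ (of_bool (i < j) + of_bool (i < k) + of_bool (j < k)))"
proof -
  define P where "P \<sigma> \<longleftrightarrow> \<sigma> permutes {i, j, k} \<and> \<sigma> i > \<sigma> j \<and> \<sigma> j > \<sigma> k" for \<sigma> :: "nat \<Rightarrow> nat"
  define \<tau> where "\<tau> a = (if a = i then x else if a = j then y else if a = k then z else a)" for a
  have "\<tau> permutes {i, j, k}"
  proof (rule bij_imp_permutes)
    have "\<tau> ` {i, j, k} = {x, y, z}"
      using distinct by (auto simp: \<tau>_def)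
    moreover have "inj_on \<tau> {i, j, k}"
      using distinct xyz(2,3) by (auto simp: inj_on_def \<tau>_def)
    ultimately show "bij_betw \<tau> {i, j, k} {i, j, k}"
      using xyz(1) by (simp only: bij_betw_def)
  qed (auto simp: \<tau>_def)
  then have \<tau>: "P \<tau>"
    using distinct xyz by (auto simp: P_def \<tau>_def)
  have eq: "\<sigma> = \<tau>" if "P \<sigma>" for \<sigma>
  proof -
    have "\<sigma> ` {i, j, k} = {i, j, k}"
      using that permutes_image[of \<sigma>] unfolding P_def by blast
    then have "{\<sigma> i, \<sigma> j, \<sigma> k} = {x, y, z}"
      unfolding xyz(1)[symmetric] by simp
    moreover have "\<sigma> k < \<sigma> j" "\<sigma> j < \<sigma> i"
      using that by (auto simp: P_def)
    ultimately have "\<sigma> i = x \<and> \<sigma> j = y \<and> \<sigma> k = z"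
      using xyz(2,3) by (auto simp: doubleton_eq_iff set_eq_iff) (metis less_asym less_trans)+
    moreover have "\<sigma> a = a" if "a \<notin> {i, j, k}" for a
      using \<open>P \<sigma>\<close> permutes_not_in[OF _ that] unfolding P_def by blast
    ultimately show ?thesis
      by (auto simp: \<tau>_def fun_eq_iff)
  qed
  have the: "(THE \<sigma>. \<sigma> permutes {i, j, k} \<and> \<sigma> i > \<sigma> j \<and> \<sigma> j > \<sigma> k) = \<tau>"
    unfolding P_def[symmetric] using \<tau> eq by (rule the_equality)
  \<comment> \<open>The values decrease along \<open>i\<close>, \<open>j\<close>, \<open>k\<close>,
    so a pair is inverted precisely when its arguments increase.\<close>
  have "inversions {i, j, k} \<tau> =
      (if i < j then {(i, j)} else {}) \<union> (if i < k then {(i, k)} else {}) \<union> (if j < k then {(j, k)} else {})"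
    using \<tau> by (auto simp: inversions_def P_def)
  then have card: "card (inversions {i, j, k} \<tau>) = of_bool (i < j) + of_bool (i < k) + of_bool (j < k)"
    using distinct by auto
  have "\<tau> i = x" "\<tau> j = y" "\<tau> k = z"
    using distinct by (auto simp: \<tau>_def)
  then show ?thesis
    using distinct by (simp add: sigma_coeff_def the card Let_def)
qed

context R_matrix_data
begin

text \<open>The right-hand side is the ratio that the structure constants produce. In each of the
  six relative orders of the indices, both sides are the same monomial in \<open>q\<close> and the
  \<open>r\<close>.\<close>

lemma sigma_coeff_eq_M:
  assumes "i \<in> {1..n}" "j \<in> {1..n}" "k \<in> {1..n}" "i \<noteq> j" "j \<noteq> k" "i \<noteq> k"
  shows "sigma_coeff q r i j k = M j i / (M k i * M j k)"
proof -
  have nz: "r a b \<noteq> 0" if "a < b" "a \<in> {i, j, k}" "b \<in> {i, j, k}" for a b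
    using that assms by (intro r_nonzero) auto
  consider "i < j" "j < k" | "i < k" "k < j" | "j < i" "i < k" | "j < k" "k < i"
    | "k < i" "i < j" | "k < j" "j < i"
    using assms(4-6) by linarith
  then show ?thesis
  proof cases
    case 1
    then show ?thesis
      using nz[of i j] nz[of j k] nz[of i k]
      by (subst sigma_coeff_eq[of i j k k j i]) (auto simp: M_less M_greater power_int_minus field_simps)
  next
    case 2
    then show ?thesis
      using nz[of i j] nz[of k j] nz[of i k]
      by (subst sigma_coeff_eq[of i j k j k i]) (auto simp: M_less M_greater power_int_minus field_simps)
  next
    case 3
    then show ?thesis
      using nz[of j i] nz[of j k] nz[of i k]
      by (subst sigma_coeff_eq[of i j k k i j]) (auto simp: M_less M_greater power_int_minus field_simps)
  next
    case 4
    then show ?thesis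
      using nz[of j i] nz[of j k] nz[of k i]
      by (subst sigma_coeff_eq[of i j k i k j]) (auto simp: M_less M_greater power_int_minus field_simps)
  next
    case 5
    then show ?thesis
      using nz[of i j] nz[of k j] nz[of k i]
      by (subst sigma_coeff_eq[of i j k j i k]) (auto simp: M_less M_greater power_int_minus field_simps)
  next
    case 6
    then show ?thesis
      using nz[of j i] nz[of k j] nz[of k i]
      by (subst sigma_coeff_eq[of i j k i j k]) (auto simp: M_less M_greater power_int_minus field_simps)
  qed
qed

section \<open>Brackets of two off-diagonal basis elements\<close>

lemma sum_w:
  assumes "m \<ge> 1"
  shows "mu * (\<Sum>a\<in>{1..<m}. w a) = w m / q - q"
proof -
  have "(\<Sum>a\<in>{1..<m}. w a) = (\<Sum>a\<in>{1..<m}. w a * u m a)"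
    by (intro sum.cong refl) (simp add: u_def)
  then show ?thesis
    using geometric_u[of m m] assms by simp
qed

text \<open>As \<open>j \<noteq> k\<close> and \<open>k \<noteq> l\<close>, every term of
  \<open>bracket_coeff\<close> containing a flip in \<open>R_inv\<close> or \<open>R_tilde\<close>
  vanishes. The remaining \<open>Q\<close> needs \<open>i = l\<close>, since
  \<open>i \<noteq> j\<close>.\<close>

lemma bracket_gen_off_diag:
  assumes "i \<in> {1..n}" "j \<in> {1..n}" "k \<in> {1..n}" "l \<in> {1..n}" "i \<noteq> j" "k \<noteq> l" "j \<noteq> k"
  shows "bracket_gen n q r i j k l =
    (if i = l then smult (mu * (M j i / (M k i * M j k))) (X k j) else 0)"
proof (rule poly_mapping_eqI, clarify)
  fix m p
  have "bracket_coeff i j k l m p =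
      (if i = l then delta k m * delta p j * (mu * (M j i / (M k i * M j k))) else 0)"
    using assms by (auto simp: bracket_coeff_def Q_def delta_def)
  then show "Poly_Mapping.lookup (bracket_gen n q r i j k l) (m, p) =
      Poly_Mapping.lookup (if i = l then smult (mu * (M j i / (M k i * M j k))) (X k j) else 0) (m, p)"
    using assms by (auto simp: lookup_bracket_gen lookup_X delta_def)
qed

text \<open>The upper end of the geometric sum cancels the single-flip term, whichever of
  \<open>i\<close> and \<open>j\<close> is smaller; only the lower end remains.\<close>

lemma bracket_gen_composable:
  assumes "i \<in> {1..n}" "j \<in> {1..n}" "l \<in> {1..n}" "i \<noteq> j" "j \<noteq> l" "i \<noteq> l"
  shows "bracket_gen n q r i j j l = - smult (mu * q / w j) (X i l)"
proof (rule poly_mapping_eqI, clarify)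
  fix m p
  have "M i i \<noteq> 0" "M i j \<noteq> 0"
    using M_nonzero assms by auto
  then have "bracket_coeff i j j l m p = delta m i * delta p l *
      ((\<Sum>a\<in>{1..<min i j}. mu\<^sup>2 * (w a / w j) * u l a)
      - (if i < j then mu * w i / w j * u l i / q else mu * u l j / q))"
    using assms
    by (auto simp: bracket_coeff_def Q_def L_eq delta_def power2_eq_square)
  also have "(\<Sum>a\<in>{1..<min i j}. mu\<^sup>2 * (w a / w j) * u l a) =
      (if i < j then mu * w i / w j * u l i / q else mu * u l j / q) - mu * q / w j"
  proof -
    \<comment> \<open>Because \<open>min i j\<close> differs from \<open>l\<close>, the jump factor
      in \<open>sum_u\<close> can be written as \<open>u l (min i j)\<close>.\<close>
    have "min i j \<noteq> l" "l \<ge> 1" "min i j \<ge> 1"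
      using assms by auto
    then have "(\<Sum>a\<in>{1..<min i j}. mu\<^sup>2 * (w a / w j) * u l a) =
        mu / w j * (w (min i j) / q * u l (min i j) - q)"
      by (subst sum_u) (auto simp: u_def)
    then show ?thesis
      using assms(4) w_nonzero[of j] by (auto simp: right_diff_distrib min_def)
  qed
  finally have "bracket_coeff i j j l m p = - (mu * q / w j) * delta m i * delta p l"
    by (simp add: mult_ac)
  then show "Poly_Mapping.lookup (bracket_gen n q r i j j l) (m, p) =
      Poly_Mapping.lookup (- smult (mu * q / w j) (X i l)) (m, p)"
    using assms by (auto simp: lookup_bracket_gen lookup_X delta_def)
qed

text \<open>The flip in \<open>R_tilde\<close> spreads over the diagonal elements
  \<open>X m m\<close> with \<open>m < j\<close> and produces the coefficients of \<open>K j\<close>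
  there. The coefficients at \<open>X i i\<close> and \<open>X j j\<close> need separate evaluation
  by geometric sums.\<close>

lemma bracket_gen_opposite:
  assumes "i \<in> {1..n}" "j \<in> {1..n}" "i \<noteq> j"
  shows "bracket_gen n q r i j j i = smult (mu * q / w j) (X j j - X i i) - smult (mu\<^sup>2 / w j) (K j)"
proof (rule poly_mapping_eqI, clarify)
  fix m p
  have nz: "M j i \<noteq> 0" "M m i \<noteq> 0" if "m \<in> {1..n}"
    using M_nonzero assms that by auto
  have sum: "(\<Sum>a\<in>{1..<min i j}. mu\<^sup>2 * (w a / w j) * u i a) = mu / w j * (w (min i j) / q - q)"
    using sum_u[of "min i j" i j] assms by simp
  \<comment> \<open>For \<open>m = i\<close> the flip in \<open>R_tilde\<close> meets the diagonal
    value \<open>q^2\<close> of \<open>u\<close> instead of an off-diagonal entry of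
    \<open>Q\<close>. Together with the geometric sum, it still yields the weight expected from
    \<open>K j\<close>, and in addition \<open>- mu * q / w j\<close>.\<close>
  have coeff_i: "mu / w j * (w (min i j) / q - q) - (if i < j then mu * w i / w j * q else mu / q) =
      - (mu * q / w j) - (if i < j then mu\<^sup>2 * (w i / w j) else 0)"
  proof (cases "i < j")
    case True
    have "m * V * (W * p - q) - m * W * V * q = - (m * q * V) - m * (q - p) * (W * V)" for m p V W :: 'k
      by (simp add: algebra_simps)
    from this[of mu "inverse (w j)" "w i" "inverse q"] show ?thesis
      using True by (simp add: divide_inverse power2_eq_square flip: mu_def)
  next
    case False
    then show ?thesis
      using assms(3) w_nonzero[of j] by (simp add: right_diff_distrib)
  qed
  define s where "s = (\<Sum>a\<in>{1..<min i j}. mu\<^sup>2 * (w a / w j) * u i a)"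
  have "bracket_coeff i j j i m p =
      delta m j * delta p j * (mu / q)
      - delta m p * (if m < j \<and> m \<noteq> i then mu\<^sup>2 * (w m / w j) else 0)
      + delta m i * delta p i * (mu / w j * (w (min i j) / q - q) - (if i < j then mu * w i / w j * q else mu / q))"
    if "m \<in> {1..n}"
  proof -
    have e1: "delta i m * delta j j * delta p i * (\<Sum>a\<in>{1..<min i j}. mu\<^sup>2 * (w a / w j) * u p a) =
        delta m i * delta p i * s"
      by (simp add: delta_def s_def)
    have e2: "delta j m * Q p i j i / (M j i * M j j) = delta m j * delta p j * (mu / q)"
      using assms(3) nz[OF that] by (auto simp: Q_def delta_def)
    have e3: "delta j j * L m j * (w m / w j) * Q p i m i / M m i =
        delta m p * (if m < j \<and> m \<noteq> i then mu\<^sup>2 * (w m / w j) else 0)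
        + delta m i * delta p i * (if i < j then mu * w i / w j * q else 0)"
      using nz[OF that] by (auto simp: Q_def L_eq delta_def u_def power2_eq_square)
    have e4: "delta i m * L j i * Q p j j i / M j j =
        delta m i * delta p i * (if j < i then mu / q else 0)"
      using assms(3) by (auto simp: Q_def L_eq delta_def u_def)
    show ?thesis
      unfolding bracket_coeff_def e1 e2 e3 e4 sum[symmetric] s_def[symmetric]
      using assms(3) by (cases i j rule: linorder_cases) (simp_all add: right_diff_distrib)
  qed
  then have coeff: "bracket_coeff i j j i m p =
      delta m j * delta p j * (mu / q) - delta m i * delta p i * (mu * q / w j)
      - delta m p * (if m < j then mu\<^sup>2 * (w m / w j) else 0)" if "m \<in> {1..n}"
    unfolding coeff_i using that assms(3) by (auto simp: delta_def)
  \<comment> \<open>This evaluates the coefficient of \<open>X j j\<close> in the multiple of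
    \<open>K j\<close>; it accounts for the difference between \<open>mu / q\<close> and
    \<open>mu * q / w j\<close>.\<close>
  have sum_K: "mu\<^sup>2 / w j * (\<Sum>a\<in>{1..<j}. w a) = mu / q - mu * q / w j"
  proof -
    have "mu\<^sup>2 / w j * (\<Sum>a\<in>{1..<j}. w a) = mu / w j * (mu * (\<Sum>a\<in>{1..<j}. w a))"
      by (simp add: power2_eq_square)
    also have "\<dots> = mu / q - mu * q / w j"
      using assms w_nonzero[of j] by (subst sum_w) (auto simp: right_diff_distrib)
    finally show ?thesis .
  qed
  have "Poly_Mapping.lookup (smult (mu\<^sup>2 / w j) (K j)) (m, p) =
      delta m p * (if m \<in> {1..<j} then mu\<^sup>2 * (w m / w j) else 0)
      - delta m j * delta p j * (mu / q - mu * q / w j)"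
    unfolding lookup_smult lookup_K sum_K[symmetric] by (simp add: delta_def)
  moreover have "Poly_Mapping.lookup (bracket_gen n q r i j j i) (m, p) =
      delta m j * delta p j * (mu / q) - delta m i * delta p i * (mu * q / w j)
      - delta m p * (if m \<in> {1..<j} then mu\<^sup>2 * (w m / w j) else 0)"
  proof (cases "m \<in> {1..n}")
    case True
    then show ?thesis
      using assms by (simp only: lookup_bracket_gen coeff) (auto simp: delta_def)
  next
    case False
    then show ?thesis
      using assms by (auto simp: lookup_bracket_gen delta_def)
  qed
  ultimately show "Poly_Mapping.lookup (bracket_gen n q r i j j i) (m, p) =
      Poly_Mapping.lookup (smult (mu * q / w j) (X j j - X i i) - smult (mu\<^sup>2 / w j) (K j)) (m, p)"
    using assms(3) by (simp add: lookup_minus lookup_X delta_def right_diff_distrib)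
qed

end

section \<open>The quantum trace\<close>

lemma bracket_add_left: "bracket n q r (x + y) z = bracket n q r x z + bracket n q r y z"
  by (simp add: bracket_def lookup_add distrib_right pm.scale_left_distrib sum.distrib)

lemma bracket_add_right: "bracket n q r x (y + z) = bracket n q r x y + bracket n q r x z"
  by (simp add: bracket_def lookup_add distrib_left pm.scale_left_distrib sum.distrib)

lemma bracket_diff_left: "bracket n q r (x - y) z = bracket n q r x z - bracket n q r y z"
  by (simp add: bracket_def lookup_minus left_diff_distrib pm.scale_left_diff_distrib sum_subtractf)

lemma bracket_diff_right: "bracket n q r x (y - z) = bracket n q r x y - bracket n q r x z"
  by (simp add: bracket_def lookup_minus right_diff_distrib pm.scale_left_diff_distrib sum_subtractf)

lemma bracket_smult_left: "bracket n q r (smult c x) y = smult c (bracket n q r x y)"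
  by (simp add: bracket_def pm.scale_sum_right mult_ac)

lemma bracket_smult_right: "bracket n q r x (smult c y) = smult c (bracket n q r x y)"
  by (simp add: bracket_def pm.scale_sum_right mult_ac)

lemma bracket_zero_left [simp]: "bracket n q r 0 y = 0"
  by (simp add: bracket_def)

lemma bracket_zero_right [simp]: "bracket n q r x 0 = 0"
  by (simp add: bracket_def)

lemma bracket_sum_left: "bracket n q r (\<Sum>a\<in>A. f a) y = (\<Sum>a\<in>A. bracket n q r (f a) y)"
  by (induction A rule: infinite_finite_induct) (simp_all add: bracket_add_left)

lemma bracket_sum_right: "bracket n q r x (\<Sum>a\<in>A. f a) = (\<Sum>a\<in>A. bracket n q r x (f a))"
  by (induction A rule: infinite_finite_induct) (simp_all add: bracket_add_right)

lemma bracket_X: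
  assumes "i \<in> {1..n}" "j \<in> {1..n}" "k \<in> {1..n}" "l \<in> {1..n}"
  shows "bracket n q r (X i j) (X k l) = bracket_gen n q r i j k l"
proof -
  have "(\<Sum>k'\<in>{1..n}. \<Sum>l'\<in>{1..n}. smult (Poly_Mapping.lookup (X i j) (i', j') * Poly_Mapping.lookup (X k l) (k', l'))
      (bracket_gen n q r i' j' k' l')) =
    (if i' = i then if j' = j then bracket_gen n q r i j k l else 0 else 0)" for i' j'
  proof -
    have "smult (Poly_Mapping.lookup (X i j) (i', j') * Poly_Mapping.lookup (X k l) (k', l'))
      (bracket_gen n q r i' j' k' l') =
      (if k' = k then if l' = l then (if i' = i then if j' = j then bracket_gen n q r i j k l else 0 else 0) else 0 else 0)" for k' l'
      by (simp add: lookup_X)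
    then show ?thesis
      using assms by (simp only: sum_delta2 finite_atLeastAtMost)
  qed
  then show ?thesis
    unfolding bracket_def using assms by (simp only: sum_delta2 finite_atLeastAtMost)
qed

lemma counit_add: "counit n (x + y) = counit n x + counit n y"
  by (simp add: counit_def lookup_add distrib_right sum.distrib)

lemma counit_diff: "counit n (x - y) = counit n x - counit n y"
  by (simp add: counit_def lookup_minus left_diff_distrib sum_subtractf)

lemma counit_smult: "counit n (smult c x) = c * counit n x"
  by (simp add: counit_def sum_distrib_left mult.assoc)

lemma counit_zero [simp]: "counit n 0 = 0"
  by (simp add: counit_def)

lemma counit_X:
  assumes "i \<in> {1..n}" "j \<in> {1..n}"
  shows "counit n (X i j) = delta i j"
proof -
  have "Poly_Mapping.lookup (X i j) (a, b) * delta a b =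
      (if a = i then if b = j then delta i j else 0 else (0::'a))" for a b
    by (simp add: lookup_X)
  then show ?thesis
    unfolding counit_def using assms by (simp only: sum_delta2 finite_atLeastAtMost)
qed

lemma subspace_sl_tilde: "pm.subspace (sl_tilde n)"
  by (simp add: sl_tilde_def)

lemma X_in_sl_tilde: "\<lbrakk>i \<in> {1..n}; j \<in> {1..n}\<rbrakk> \<Longrightarrow> X i j \<in> sl_tilde n"
  unfolding sl_tilde_def by (rule pm.span_base) blast

lemma subspace_sl: "pm.subspace (sl n)"
  unfolding sl_def using subspace_sl_tilde[of n]
  by (auto simp: pm.subspace_def counit_add counit_smult)

lemma tr_in_sl_tilde: "qtr n q \<in> sl_tilde n"
  unfolding qtr_def by (intro pm.subspace_sum pm.subspace_scale subspace_sl_tilde X_in_sl_tilde)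

text \<open>The expansion map \<open>e\<close> is linear, so its fixed points form a subspace; this
  contains the spanning elements \<open>X i j\<close>.\<close>

lemma sl_tilde_expand:
  fixes x :: "(nat \<times> nat) \<Rightarrow>\<^sub>0 'k::field"
  assumes "x \<in> sl_tilde n"
  shows "x = (\<Sum>i\<in>{1..n}. \<Sum>j\<in>{1..n}. smult (Poly_Mapping.lookup x (i, j)) (X i j))"
proof -
  define e where "e x = (\<Sum>i\<in>{1..n}. \<Sum>j\<in>{1..n}. smult (Poly_Mapping.lookup x (i, j)) (X i j))"
    for x :: "(nat \<times> nat) \<Rightarrow>\<^sub>0 'k"
  let ?S = "{x. e x = x}"
  have "e (x + y) = e x + e y" "e (smult c x) = smult c (e x)" "e 0 = 0" for x y c
    by (simp_all add: e_def lookup_add pm.scale_left_distrib sum.distrib pm.scale_sum_right)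
  then have "pm.subspace ?S"
    by (simp add: pm.subspace_def)
  moreover have "X i j \<in> ?S" if "i \<in> {1..n}" "j \<in> {1..n}" for i j
  proof -
    have "(\<Sum>a\<in>{1..n}. \<Sum>b\<in>{1..n}. smult (Poly_Mapping.lookup (X i j) (a, b)) (X a b)) =
        (\<Sum>a\<in>{1..n}. \<Sum>b\<in>{1..n}. if a = i then if b = j then (X i j :: _ \<Rightarrow>\<^sub>0 'k) else 0 else 0)"
      by (intro sum.cong refl) (simp add: lookup_X)
    also have "\<dots> = X i j"
      using that by (intro sum_delta2) simp_all
    finally show ?thesis
      by (simp only: e_def mem_Collect_eq)
  qed
  ultimately have "sl_tilde n \<subseteq> ?S"
    unfolding sl_tilde_def by (intro pm.span_minimal) auto
  then have "e x = x"
    using assms by blast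
  then show ?thesis
    by (simp add: e_def)
qed

text \<open>The differences \<open>X i i - X 1 1\<close> telescope into the \<open>h k\<close>. An
  element of the kernel does not change if each \<open>X i i\<close> is replaced by
  \<open>X i i - X 1 1\<close>.\<close>

lemma sl_eq_span:
  "sl n = (pm.span ({X i j | i j. i \<in> {1..n} \<and> j \<in> {1..n} \<and> i \<noteq> j} \<union> {h k | k. k \<in> {1..<n}}) ::
    ((nat \<times> nat) \<Rightarrow>\<^sub>0 'k::field) set)" (is "_ = pm.span ?B")
proof
  have "?B \<subseteq> sl n"
    by (auto simp: sl_def h_def counit_diff counit_X delta_def
        intro!: X_in_sl_tilde pm.subspace_diff[OF subspace_sl_tilde])
  then show "pm.span ?B \<subseteq> sl n"
    by (intro pm.span_minimal subspace_sl)
next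
  have off: "X i j \<in> pm.span ?B" if "i \<in> {1..n}" "j \<in> {1..n}" "i \<noteq> j" for i j
    using that by (intro pm.span_base) blast
  have diag: "X i i - X 1 1 \<in> pm.span ?B" if "i \<in> {1..n}" for i
    using that
  proof (induction i)
    case (Suc i)
    show ?case
    proof (cases "i = 0")
      case False
      with Suc.prems have "i \<in> {1..<n}"
        by auto
      then have "X i i - X 1 1 \<in> pm.span ?B"
        by (intro Suc.IH) auto
      moreover have "h i \<in> pm.span ?B"
        using \<open>i \<in> {1..<n}\<close> by (intro pm.span_base) blast
      ultimately have "(X i i - X 1 1) - h i \<in> pm.span ?B"
        by (rule pm.span_diff)
      then show ?thesis
        by (simp add: h_def)
    qed (simp add: pm.span_zero)
  qed simp
  show "sl n \<subseteq> pm.span ?B"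
  proof
    fix x :: "(nat \<times> nat) \<Rightarrow>\<^sub>0 'k" assume x: "x \<in> sl n"
    let ?c = "\<lambda>i j. Poly_Mapping.lookup x (i, j)"
    \<comment> \<open>The subtracted term is zero because \<open>counit n x = 0\<close>; it is
      inserted so that it can be distributed over the diagonal elements.\<close>
    have "x = (\<Sum>i\<in>{1..n}. \<Sum>j\<in>{1..n}. smult (?c i j) (X i j)) - smult (counit n x) (X 1 1)"
      using x sl_tilde_expand[of x n] by (simp add: sl_def)
    also have "\<dots> = (\<Sum>i\<in>{1..n}. \<Sum>j\<in>{1..n}. smult (?c i j) (X i j - smult (delta i j) (X 1 1)))"
      by (simp add: counit_def pm.scale_sum_left pm.scale_right_diff_distrib sum_subtractf)
    also have "\<dots> \<in> pm.span ?B"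
      using off diag by (intro pm.span_sum pm.span_scale) (auto simp: delta_def)
    finally show "x \<in> pm.span ?B" .
  qed
qed

section \<open>Powers of \<open>q\<close>, \<open>q\<close>-integers, and the passage from
  \<open>K\<close> to \<open>H\<close>\<close>

context R_matrix_data
begin

lemma powi_w: "q powi (- 2 * int i) = inverse (w i)" "q powi (- 2 * (int i - 1)) = q\<^sup>2 * inverse (w i)"
proof -
  have w: "q powi (2 * int i) = w i"
    using power_int_of_nat[of q "2 * i"] by simp
  show "q powi (- 2 * int i) = inverse (w i)"
    using w by (simp add: power_int_minus)
  show "q powi (- 2 * (int i - 1)) = q\<^sup>2 * inverse (w i)"
    using w by (simp add: right_diff_distrib power_int_diff divide_inverse)
qed

lemma w_Suc: "w (Suc i) = q\<^sup>2 * w i"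
  by (simp add: power2_eq_square)

text \<open>Each \<open>X a a - X (k + 1) (k + 1)\<close> is \<open>X a a - X k k\<close> plus
  \<open>h k\<close>, and the first part vanishes for \<open>a = k\<close>.\<close>

lemma K_Suc: "K (Suc k) = K k + smult (\<Sum>a\<in>{1..k}. w a) (h k)"
proof -
  have "K (Suc k) = (\<Sum>a\<in>{1..k}. smult (w a) (X a a - X k k) + smult (w a) (h k))"
    unfolding K_def atLeastLessThanSuc_atLeastAtMost
    by (intro sum.cong refl) (simp add: h_def flip: pm.scale_right_distrib)
  also have "\<dots> = (\<Sum>a\<in>{1..k}. smult (w a) (X a a - X k k)) + smult (\<Sum>a\<in>{1..k}. w a) (h k)"
    by (simp add: sum.distrib pm.scale_sum_left)
  also have "(\<Sum>a\<in>{1..k}. smult (w a) (X a a - X k k)) = K k"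
    unfolding K_def by (intro sum.mono_neutral_right) auto
  finally show ?thesis .
qed

text \<open>The factor \<open>mu^2\<close> covers the degenerate case: if \<open>q^2 = 1\<close>,
  then \<open>qint\<close> is \<open>0\<close> by the convention on division and the sum need not
  be, but \<open>mu = 0\<close>.\<close>

lemma qint_eq_sum: "mu\<^sup>2 * (q\<^sup>2 * qint q k) = mu\<^sup>2 * (\<Sum>a\<in>{1..k}. w a)"
proof (cases "q\<^sup>2 = 1")
  case True
  then have "mu = 0"
    using mu_times_q by simp
  then show ?thesis
    by simp
next
  case False
  have "mu * (\<Sum>a\<in>{1..k}. w a) = q * w k - q"
    using sum_w[of "Suc k"] by (simp add: atLeastLessThanSuc_atLeastAtMost)
  then have "q * (mu * (\<Sum>a\<in>{1..k}. w a)) = q * (q * w k - q)"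
    by (rule arg_cong)
  then have "(q\<^sup>2 - 1) * (\<Sum>a\<in>{1..k}. w a) = q\<^sup>2 * (w k - 1)"
    unfolding mu_times_q[symmetric] by (simp only: power2_eq_square right_diff_distrib mult_ac mult_1_left mult_1_right)
  moreover have "(q\<^sup>2 - 1) * (q\<^sup>2 * qint q k) = q\<^sup>2 * (w k - 1)"
    using False by (simp add: qint_def field_simps)
  ultimately show ?thesis
    using False by (metis mult_left_cancel right_minus_eq)
qed

text \<open>By \<open>K_Suc\<close> and \<open>qint_eq_sum\<close> both sides satisfy the same
  recursion. The factor \<open>mu^2\<close> is kept for the case \<open>q^2 = 1\<close>.\<close>

lemma smult_H: "smult (mu\<^sup>2) (smult (q\<^sup>2) (H q k)) = smult (mu\<^sup>2) (K k)"
proof (induction k)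
  case 0
  show ?case by (simp add: H_def K_def)
next
  case (Suc k)
  \<comment> \<open>For \<open>k = 0\<close> no new summand appears on the left, in agreement with
    \<open>qint q 0 = 0\<close>.\<close>
  have "H q (Suc k) = H q k + smult (qint q k) (h k)"
    by (cases "k = 0") (simp_all add: H_def qint_def)
  then show ?case
    using Suc qint_eq_sum[of k] by (simp add: K_Suc pm.scale_right_distrib mult.assoc)
qed

lemma smult_H': "smult (mu\<^sup>2 * c) (H q k) = smult (mu\<^sup>2 * (c / q\<^sup>2)) (K k)"
proof -
  have "smult (mu\<^sup>2 * c) (H q k) = smult (c / q\<^sup>2) (smult (mu\<^sup>2) (smult (q\<^sup>2) (H q k)))"
    by (simp add: mult_ac)
  then show ?thesis
    unfolding smult_H by (simp add: mult_ac)
qed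

section \<open>Brackets with the quantum trace\<close>

abbreviation br where "br \<equiv> bracket n q r"
abbreviation tr where "tr \<equiv> qtr n q"

lemma bracket_X_X_diag:
  assumes "i \<in> {1..n}" "k \<in> {1..n}"
  shows "br (X i i) (X k k) =
    X k k + smult (mu\<^sup>2) (if k < i then X k k - X i i else if k = i then - smult (inverse (w i)) (K i) else 0)"
  using assms by (auto simp: bracket_X bracket_gen_diag_diag bracket_gen_diag_same divide_inverse)

text \<open>For \<open>i = j\<close> the corrections from \<open>k < i\<close> add up to
  \<open>mu^2\<close> times \<open>K i\<close>, which the bracket of \<open>X i i\<close> with
  itself takes away again. For \<open>i \<noteq> j\<close> the weighted sum of the scalars vanishes
  by \<open>sum_w\<close>.\<close>

lemma bracket_X_tr:
  assumes "i \<in> {1..n}" "j \<in> {1..n}"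
  shows "br (X i j) tr = smult (delta i j) tr"
proof (cases "i = j")
  case True
  have "br (X i i) tr = (\<Sum>k\<in>{1..n}. smult (w k) (X k k)
      + smult (mu\<^sup>2) (if k \<in> {1..<i} then smult (w k) (X k k - X i i) else 0)
      - (if k = i then smult (mu\<^sup>2) (K i) else 0))"
    unfolding qtr_def bracket_sum_right bracket_smult_right using assms
    by (intro sum.cong refl) (auto simp: bracket_X_X_diag pm.scale_right_distrib mult_ac)
  also have "\<dots> = tr + smult (mu\<^sup>2) (\<Sum>k\<in>{1..n}. if k \<in> {1..<i} then smult (w k) (X k k - X i i) else 0)
      - smult (mu\<^sup>2) (K i)"
    using assms by (simp add: sum.distrib sum_subtractf qtr_def pm.scale_sum_right)
  also have "(\<Sum>k\<in>{1..n}. if k \<in> {1..<i} then smult (w k) (X k k - X i i) else 0) = K i"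
    unfolding K_def using assms by (intro sum.mono_neutral_cong_right) auto
  finally show ?thesis
    using True by (simp add: delta_def)
next
  case False
  define c where "c k = mu * ((if k = i then inverse q else 0) - (if k = j then q / w j else 0) - (if k < i then mu else 0))" for k
  have "br (X i j) tr = smult (\<Sum>k\<in>{1..n}. w k * c k) (X i j)"
    unfolding qtr_def bracket_sum_right bracket_smult_right pm.scale_sum_left using assms False
    by (intro sum.cong refl) (simp add: bracket_X bracket_gen_diag_right c_def)
  also have "(\<Sum>k\<in>{1..n}. w k * c k) = 0"
  proof -
    have "w k * c k = mu * ((if k = i then w i / q else 0) - (if k = j then q else 0)
        - (if k \<in> {1..<i} then mu * w k else 0))" if "k \<in> {1..n}" for k
      using that False by (auto simp: c_def algebra_simps divide_inverse)
    then have "(\<Sum>k\<in>{1..n}. w k * c k) = (\<Sum>k\<in>{1..n}. mu * ((if k = i then w i / q else 0)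
        - (if k = j then q else 0) - (if k \<in> {1..<i} then mu * w k else 0)))"
      by (intro sum.cong refl)
    also have "\<dots> = mu * (w i / q - q - (\<Sum>k\<in>{1..n}. if k \<in> {1..<i} then mu * w k else 0))"
      using assms by (simp add: sum_subtractf flip: sum_distrib_left)
    also have "(\<Sum>k\<in>{1..n}. if k \<in> {1..<i} then mu * w k else 0) = (\<Sum>k\<in>{1..<i}. mu * w k)"
      using assms by (intro sum.mono_neutral_cong_right) auto
    also have "\<dots> = w i / q - q"
      using sum_w[of i] assms by (simp add: sum_distrib_left)
    finally show ?thesis by simp
  qed
  finally show ?thesis
    using False by (simp add: delta_def)
qed

lemma bracket_tr_right:
  assumes "x \<in> sl_tilde n"
  shows "br x tr = smult (counit n x) tr"
proof -
  have "pm.subspace {x. br x tr = smult (counit n x) tr}"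
    by (rule pm.subspaceI)
      (simp_all add: bracket_add_left bracket_smult_left counit_add counit_smult pm.scale_left_distrib)
  then have "sl_tilde n \<subseteq> {x. br x tr = smult (counit n x) tr}"
    unfolding sl_tilde_def by (intro pm.span_minimal) (auto simp: bracket_X_tr counit_X)
  then show ?thesis
    using assms by auto
qed

lemma counit_tr: "counit n tr = (\<Sum>i\<in>{1..n}. w i)"
  by (rule counit_qtr)

lemma mu_counit_tr: "l \<le> n \<Longrightarrow> mu * (\<Sum>i\<in>{l<..n}. w i) = mu * counit n tr - q * w l + q"
proof -
  assume "l \<le> n"
  then have "{1..n} = {1..<Suc l} \<union> {l<..n}" 
    by auto
  then have "counit n tr = (\<Sum>i\<in>{1..<Suc l}. w i) + (\<Sum>i\<in>{l<..n}. w i)"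
    unfolding counit_tr by (simp only:) (intro sum.union_disjoint, auto)
  moreover have "mu * (\<Sum>i\<in>{1..<Suc l}. w i) = q * w l - q"
    by (subst sum_w) simp_all
  ultimately show ?thesis
    by (simp only: distrib_left) simp
qed

text \<open>For \<open>k = l\<close> the corrections come from \<open>i > k\<close>; they are
  written as those for all \<open>i\<close> minus those for \<open>i < k\<close>. The latter form
  \<open>K k\<close> and cancel against the bracket of \<open>X k k\<close> with itself. For
  \<open>k \<noteq> l\<close> the boundary terms of the tail sum over \<open>i > l\<close> cancel
  the scalars at \<open>i = l\<close> and \<open>i = k\<close>.\<close>

lemma bracket_tr_X:
  assumes "k \<in> {1..n}" "l \<in> {1..n}"
  shows "br tr (X k l) = smult (counit n tr * (1 + mu\<^sup>2)) (X k l) - smult (mu\<^sup>2 * delta k l) tr"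
proof (cases "k = l")
  case True
  have "br tr (X k k) = (\<Sum>i\<in>{1..n}. smult (w i) (X k k)
      - smult (mu\<^sup>2) (smult (w i) (X i i - X k k))
      + smult (mu\<^sup>2) (if i \<in> {1..<k} then smult (w i) (X i i - X k k) else 0)
      - (if i = k then smult (mu\<^sup>2) (K k) else 0))"
    unfolding qtr_def bracket_sum_left bracket_smult_left
  proof (intro sum.cong refl)
    fix i assume "i \<in> {1..n}"
    then show "smult (w i) (br (X i i) (X k k)) = smult (w i) (X k k)
      - smult (mu\<^sup>2) (smult (w i) (X i i - X k k))
      + smult (mu\<^sup>2) (if i \<in> {1..<k} then smult (w i) (X i i - X k k) else 0)
      - (if i = k then smult (mu\<^sup>2) (K k) else 0)"
      using assms
      by (cases i k rule: linorder_cases)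
        (simp_all add: bracket_X_X_diag pm.scale_right_distrib pm.scale_right_diff_distrib mult_ac)
  qed
  also have "\<dots> = smult (counit n tr) (X k k) - smult (mu\<^sup>2) (\<Sum>i\<in>{1..n}. smult (w i) (X i i - X k k))
      + smult (mu\<^sup>2) (\<Sum>i\<in>{1..n}. if i \<in> {1..<k} then smult (w i) (X i i - X k k) else 0) - smult (mu\<^sup>2) (K k)"
    using assms by (simp only: sum.distrib sum_subtractf counit_tr pm.scale_sum_right pm.scale_sum_left) simp
  also have "(\<Sum>i\<in>{1..n}. if i \<in> {1..<k} then smult (w i) (X i i - X k k) else 0) = K k"
    unfolding K_def using assms by (intro sum.mono_neutral_cong_right) auto
  also have "(\<Sum>i\<in>{1..n}. smult (w i) (X i i - X k k)) = tr - smult (counit n tr) (X k k)"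
    unfolding counit_tr unfolding qtr_def by (simp add: pm.scale_right_diff_distrib sum_subtractf pm.scale_sum_left)
  finally show ?thesis
    using True by (simp add: delta_def pm.scale_right_diff_distrib distrib_left pm.scale_left_distrib mult_ac)
next
  case False
  define c where "c i = 1 + (if i = l then mu * q else if l < i then mu\<^sup>2 else 0) - (if i = k then mu * q / w k else 0)" for i
  have "br tr (X k l) = smult (\<Sum>i\<in>{1..n}. w i * c i) (X k l)"
    unfolding qtr_def bracket_sum_left bracket_smult_left pm.scale_sum_left using assms False
    by (intro sum.cong refl) (simp add: bracket_X bracket_gen_diag_left c_def)
  also have "(\<Sum>i\<in>{1..n}. w i * c i) = (\<Sum>i\<in>{1..n}. w i + (if i = l then mu * (q * w l) else 0)
      + (if i \<in> {l<..n} then mu\<^sup>2 * w i else 0) - (if i = k then mu * q else 0))"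
    by (intro sum.cong refl) (auto simp: c_def algebra_simps)
  also have "\<dots> = counit n tr + mu * (q * w l) + (\<Sum>i\<in>{1..n}. if i \<in> {l<..n} then mu\<^sup>2 * w i else 0) - mu * q"
    using assms by (simp add: sum.distrib sum_subtractf counit_tr)
  also have "(\<Sum>i\<in>{1..n}. if i \<in> {l<..n} then mu\<^sup>2 * w i else 0) = (\<Sum>i\<in>{l<..n}. mu\<^sup>2 * w i)"
    by (intro sum.mono_neutral_cong_right) auto
  also have "\<dots> = mu * (mu * counit n tr - q * w l + q)"
    using assms by (subst mu_counit_tr[symmetric]) (simp_all add: sum_distrib_left power2_eq_square mult.assoc)
  finally show ?thesis
    using False by (simp add: delta_def algebra_simps power2_eq_square)
qed

lemma bracket_tr_left:
  assumes "x \<in> sl_tilde n"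
  shows "br tr x = smult (counit n tr * (1 + mu\<^sup>2)) x - smult (mu\<^sup>2 * counit n x) tr"
proof -
  let ?S = "{x. br tr x = smult (counit n tr * (1 + mu\<^sup>2)) x - smult (mu\<^sup>2 * counit n x) tr}"
  have "pm.subspace ?S"
    by (rule pm.subspaceI)
      (simp_all add: bracket_add_right bracket_smult_right counit_add counit_smult pm.scale_left_distrib
        pm.scale_right_distrib pm.scale_right_diff_distrib distrib_left mult_ac)
  then have "sl_tilde n \<subseteq> ?S"
    unfolding sl_tilde_def by (intro pm.span_minimal) (auto simp: bracket_tr_X counit_X)
  then show ?thesis
    using assms by auto
qed

end

section \<open>The coaction\<close>

locale SL_quantum_group_R = SL_quantum_group scale n q r t S + R_matrix_data n q r
  for scale :: "'k::field \<Rightarrow> 'a::ring_1 \<Rightarrow> 'a" and n q r t S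
begin

section \<open>Relations and antipode axioms for the generators\<close>

lemma eval_free_eq:
  assumes "finite A" "Poly_Mapping.keys f \<subseteq> A"
  shows "eval_free scale t f = (\<Sum>v\<in>A. scale (Poly_Mapping.lookup f v) (eval_word t v))"
  unfolding eval_free_def using assms
  by (intro sum.mono_neutral_left) (auto simp: in_keys_iff)

lemma eval_free_add: "eval_free scale t (f + g) = eval_free scale t f + eval_free scale t g"
proof -
  let ?A = "Poly_Mapping.keys f \<union> Poly_Mapping.keys g"
  have A: "finite ?A" "Poly_Mapping.keys (f + g) \<subseteq> ?A"
    by (simp_all add: keys_add)
  show ?thesis
    using A by (simp add: eval_free_eq[of ?A] lookup_add scale_left_distrib sum.distrib)
qed

lemma eval_free_smult: "eval_free scale t (smult c f) = scale c (eval_free scale t f)"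
proof -
  have "Poly_Mapping.keys (smult c f) \<subseteq> Poly_Mapping.keys f"
    by (auto simp: in_keys_iff)
  then show ?thesis
    by (simp add: eval_free_eq[of "Poly_Mapping.keys f"] scale_sum_right)
qed

lemma eval_free_diff: "eval_free scale t (f - g) = eval_free scale t f - eval_free scale t g"
  using eval_free_add[of "f - g" g] by simp

lemma eval_free_gen_gen: "eval_free scale t (gen i j * gen k l) = t i j * t k l"
  by (simp add: eval_free_def gen_def mult_single plus_word_def eval_word_def)

lemma sum_smult_R_mat_upper:
  assumes "i \<in> {1..n}" "j \<in> {1..n}"
  shows "(\<Sum>a\<in>{1..n}. \<Sum>b\<in>{1..n}. smult (R_mat q r i a j b) (F a b)) =
    smult (M i j) (F i j) + smult (L i j) (F j i)"
proof -
  have "smult (R_mat q r i a j b) (F a b) =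
      (if a = i then if b = j then smult (M i j) (F i j) else 0 else 0) +
      (if a = j then if b = i then smult (L i j) (F j i) else 0 else 0)" for a b
    by (auto simp: R_mat_def delta_def L_eq)
  then show ?thesis
    using assms by (simp add: sum.distrib sum_delta2)
qed

lemma sum_smult_R_mat_lower:
  assumes "k \<in> {1..n}" "l \<in> {1..n}"
  shows "(\<Sum>a\<in>{1..n}. \<Sum>b\<in>{1..n}. smult (R_mat q r a k b l) (F a b)) =
    smult (M k l) (F k l) + smult (L l k) (F l k)"
proof -
  have "smult (R_mat q r a k b l) (F a b) =
      (if a = k then if b = l then smult (M k l) (F k l) else 0 else 0) +
      (if a = l then if b = k then smult (L l k) (F l k) else 0 else 0)" for a b
    by (auto simp: R_mat_def delta_def L_eq)
  then show ?thesis
    using assms by (simp add: sum.distrib sum_delta2)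
qed

lemma gen_times_gen_free_alg:
  "\<lbrakk>i \<in> {1..n}; j \<in> {1..n}; k \<in> {1..n}; l \<in> {1..n}\<rbrakk> \<Longrightarrow> smult c (gen i j * gen k l) \<in> free_alg n"
  by (auto simp: free_alg_def gen_def mult_single plus_word_def words_def in_keys_iff lookup_single when_def
      split: if_splits)

text \<open>The relation lies in the ideal, so its evaluation is zero. On each side the sums against
  \<open>R\<close> reduce to a diagonal and a flip term.\<close>

lemma frt_relation:
  assumes "i \<in> {1..n}" "j \<in> {1..n}" "k \<in> {1..n}" "l \<in> {1..n}"
  shows "scale (M i j) (t i k * t j l) + scale (L i j) (t j k * t i l) =
    scale (M k l) (t j l * t i k) + scale (L l k) (t j k * t i l)"
proof -
  have rel: "frt_rel n q r i k j l = smult (M i j) (gen i k * gen j l) + smult (L i j) (gen j k * gen i l)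
      - (smult (M k l) (gen j l * gen i k) + smult (L l k) (gen j k * gen i l))"
    unfolding frt_rel_def using assms by (simp only: sum_smult_R_mat_upper sum_smult_R_mat_lower)
  have add: "f + g \<in> free_alg n" "f - g \<in> free_alg n"
    if "f \<in> free_alg n" "g \<in> free_alg n" for f g :: "(nat \<times> nat) word \<Rightarrow>\<^sub>0 'k"
    using that keys_add[of f g] keys_diff[of f g] by (auto simp: free_alg_def)
  have free: "frt_rel n q r i k j l \<in> free_alg n"
    unfolding rel using assms by (intro add gen_times_gen_free_alg)
  have one: "1 \<in> free_alg n"
    by (simp add: free_alg_def words_def zero_word_def flip: single_one)
  have "frt_rel n q r i k j l \<in> SL_relations n q r"
    using assms by (auto simp: SL_relations_def)
  then have "1 * frt_rel n q r i k j l * 1 \<in> SL_ideal n q r"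
    unfolding SL_ideal_def using one by (intro pm.span_base) blast
  then have "eval_free scale t (frt_rel n q r i k j l) = 0"
    using eval_kernel[OF free] by simp
  then show ?thesis
    by (simp add: rel eval_free_add eval_free_diff eval_free_smult eval_free_gen_gen)
qed

text \<open>Distinct middle indices give distinct pairs of words, so every key of the coproduct of a
  single letter has coefficient \<open>1\<close>. This turns the antipode axioms on words into
  matrix identities for \<open>t\<close>.\<close>

lemma sum_coprod_word_gen:
  fixes F :: "(nat \<times> nat) word \<Rightarrow> (nat \<times> nat) word \<Rightarrow> 'a"
  shows "(\<Sum>(u, v)\<in>Poly_Mapping.keys (coprod_word n (Word [(i, j)]) :: _ \<Rightarrow>\<^sub>0 'k).
      scale (Poly_Mapping.lookup (coprod_word n (Word [(i, j)])) (u, v)) (F u v)) =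
    (\<Sum>a\<in>{1..n}. F (Word [(i, a)]) (Word [(a, j)]))"
proof -
  define p where "p = (coprod_word n (Word [(i, j)]) :: _ \<Rightarrow>\<^sub>0 'k)"
  define f where "f a = (Word [(i, a)], Word [(a, j)])" for a :: nat
  have inj: "inj_on f A" for A
    by (auto simp: f_def inj_on_def)
  have "p = (\<Sum>a\<in>{1..n}. Poly_Mapping.single (f a) 1)"
    by (simp add: p_def coprod_word_def f_def)
  then have "Poly_Mapping.lookup p x = (\<Sum>a\<in>{1..n}. if f a = x then 1 else 0)" for x
    by (simp add: lookup_sum lookup_single when_def)
  moreover have "(\<Sum>a\<in>{1..n}. if f a = x then 1 else 0) = (if x \<in> f ` {1..n} then 1 else (0::'k))" for x
  proof (cases "x \<in> f ` {1..n}")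
    case True
    then obtain b where b: "b \<in> {1..n}" "x = f b"
      by blast
    then have "f a = x \<longleftrightarrow> a = b" for a
      using inj[of UNIV] by (auto dest: injD)
    then show ?thesis
      using b True by simp
  next
    case False
    then show ?thesis
      by (auto intro!: sum.neutral)
  qed
  ultimately have lookup: "Poly_Mapping.lookup p x = (if x \<in> f ` {1..n} then 1 else 0)" for x
    by simp
  then have "x \<in> Poly_Mapping.keys p \<longleftrightarrow> x \<in> f ` {1..n}" for x
    by (simp only: in_keys_iff) simp
  then have "Poly_Mapping.keys p = f ` {1..n}"
    by blast
  then have "(\<Sum>(u, v)\<in>Poly_Mapping.keys p. scale (Poly_Mapping.lookup p (u, v)) (F u v)) =
      (\<Sum>(u, v)\<in>f ` {1..n}. F u v)"
    by (intro sum.cong) (auto simp: lookup)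
  also have "\<dots> = (\<Sum>a\<in>{1..n}. F (Word [(i, a)]) (Word [(a, j)]))"
    by (subst sum.reindex[OF inj]) (simp add: f_def)
  finally show ?thesis
    unfolding p_def .
qed

lemma antipode_gen_left:
  assumes "i \<in> {1..n}" "j \<in> {1..n}"
  shows "(\<Sum>a\<in>{1..n}. S (t i a) * t a j) = (if i = j then 1 else 0)"
  using antipode_left[of "Word [(i, j)]"] assms
  unfolding sum_coprod_word_gen[of i j "\<lambda>u v. S (eval_word t u) * eval_word t v"]
  by (simp add: words_def eval_word_def counit_word_def delta_def)

lemma antipode_gen_right:
  assumes "i \<in> {1..n}" "j \<in> {1..n}"
  shows "(\<Sum>a\<in>{1..n}. t i a * S (t a j)) = (if i = j then 1 else 0)"
  using antipode_right[of "Word [(i, j)]"] assms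
  unfolding sum_coprod_word_gen[of i j "\<lambda>u v. eval_word t u * S (eval_word t v)"]
  by (simp add: words_def eval_word_def counit_word_def delta_def)

text \<open>The relations \<open>S(t\<^sub>2) R t\<^sub>1 = t\<^sub>1 R S(t\<^sub>2)\<close>.\<close>

lemma frt_antipode_relation:
  assumes "i \<in> {1..n}" "k \<in> {1..n}" "p \<in> {1..n}" "s \<in> {1..n}"
  shows "scale (M i s) (S (t p s) * t i k) + (if i = s then \<Sum>j\<in>{1..n}. scale (L i j) (S (t p j) * t j k) else 0) =
    scale (M k p) (t i k * S (t p s)) + (if p = k then \<Sum>l\<in>{1..n}. scale (L l k) (t i l * S (t l s)) else 0)"
proof -
  \<comment> \<open>\<open>D\<close> multiplies by the antipode on both sides in the second matrix
    slot. In each of the four terms of \<open>frt_relation\<close> one of the two sums then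
    collapses by an antipode axiom.\<close>
  define D where "D F = (\<Sum>j\<in>{1..n}. \<Sum>l\<in>{1..n}. S (t p j) * F j l * S (t l s))" for F
  have D_swap: "D F = (\<Sum>l\<in>{1..n}. \<Sum>j\<in>{1..n}. S (t p j) * F j l * S (t l s))" for F
    unfolding D_def by (rule sum.swap)
  have D_add: "D (\<lambda>j l. F j l + G j l) = D F + D G" for F G
    by (simp add: D_def distrib_left distrib_right sum.distrib)
  have "D (\<lambda>j l. scale (M i j) (t i k * t j l)) =
      (\<Sum>j\<in>{1..n}. scale (M i j) (S (t p j) * t i k * (\<Sum>l\<in>{1..n}. t j l * S (t l s))))"
    by (simp add: D_def scale_mult_left scale_mult_right scale_sum_right sum_distrib_left mult.assoc)
  also have "\<dots> = (\<Sum>j\<in>{1..n}. if j = s then scale (M i s) (S (t p s) * t i k) else 0)"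
    using assms by (intro sum.cong refl) (simp add: antipode_gen_right del: One_nat_def)
  finally have 1: "D (\<lambda>j l. scale (M i j) (t i k * t j l)) = scale (M i s) (S (t p s) * t i k)"
    using assms by simp
  have "D (\<lambda>j l. scale (L i j) (t j k * t i l)) =
      (\<Sum>j\<in>{1..n}. scale (L i j) (S (t p j) * t j k * (\<Sum>l\<in>{1..n}. t i l * S (t l s))))"
    by (simp add: D_def scale_mult_left scale_mult_right scale_sum_right sum_distrib_left mult.assoc)
  then have 2: "D (\<lambda>j l. scale (L i j) (t j k * t i l)) =
      (if i = s then \<Sum>j\<in>{1..n}. scale (L i j) (S (t p j) * t j k) else 0)"
    using assms by (simp add: antipode_gen_right del: One_nat_def)
  have "D (\<lambda>j l. scale (M k l) (t j l * t i k)) =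
      (\<Sum>l\<in>{1..n}. scale (M k l) ((\<Sum>j\<in>{1..n}. S (t p j) * t j l) * (t i k * S (t l s))))"
    by (simp add: D_swap scale_mult_left scale_mult_right scale_sum_right sum_distrib_right mult.assoc)
  also have "\<dots> = (\<Sum>l\<in>{1..n}. if l = p then scale (M k p) (t i k * S (t p s)) else 0)"
    using assms by (intro sum.cong refl) (simp add: antipode_gen_left del: One_nat_def)
  finally have 3: "D (\<lambda>j l. scale (M k l) (t j l * t i k)) = scale (M k p) (t i k * S (t p s))"
    using assms by simp
  have "D (\<lambda>j l. scale (L l k) (t j k * t i l)) =
      (\<Sum>l\<in>{1..n}. scale (L l k) ((\<Sum>j\<in>{1..n}. S (t p j) * t j k) * (t i l * S (t l s))))"
    by (simp add: D_swap scale_mult_left scale_mult_right scale_sum_right sum_distrib_right mult.assoc)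
  then have 4: "D (\<lambda>j l. scale (L l k) (t j k * t i l)) =
      (if p = k then \<Sum>l\<in>{1..n}. scale (L l k) (t i l * S (t l s)) else 0)"
    using assms by (simp add: antipode_gen_left del: One_nat_def)
  have "D (\<lambda>j l. scale (M i j) (t i k * t j l) + scale (L i j) (t j k * t i l)) =
      D (\<lambda>j l. scale (M k l) (t j l * t i k) + scale (L l k) (t j k * t i l))"
    unfolding D_def
  proof (intro sum.cong refl)
    fix j l assume "j \<in> {1..n}" "l \<in> {1..n}"
    then show "S (t p j) * (scale (M i j) (t i k * t j l) + scale (L i j) (t j k * t i l)) * S (t l s) =
        S (t p j) * (scale (M k l) (t j l * t i k) + scale (L l k) (t j k * t i l)) * S (t l s)"
      using assms by (intro arg_cong[OF frt_relation, of _ _ _ _ "\<lambda>z. S (t p j) * z * S (t l s)"])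
  qed
  then show ?thesis
    unfolding D_add 1 2 3 4 .
qed

text \<open>Up to the scalar in front of \<open>tr\<close>, \<open>T b a\<close> is the coefficient
  of \<open>X a b\<close> in the coaction on \<open>tr\<close>; see
  \<open>coaction_tr\<close>.\<close>

definition T :: "nat \<Rightarrow> nat \<Rightarrow> 'a" where
  "T i s = (\<Sum>k\<in>{1..n}. scale (w k) (S (t k s) * t i k))"

text \<open>Put \<open>p = k\<close> in \<open>frt_antipode_relation\<close>, multiply by
  \<open>w k\<close> and sum over \<open>k\<close>. On the right, the diagonal weight
  \<open>q * w l\<close> and the flip weights, \<open>mu\<close> times the tail sum of
  \<open>w\<close> beyond \<open>l\<close>, add up to a constant independent of \<open>l\<close>.
  Hence an antipode axiom applies.\<close>

lemma T_relation:
  assumes "i \<in> {1..n}" "s \<in> {1..n}"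
  shows "scale (M i s) (T i s) + (if i = s then scale mu (\<Sum>j\<in>{i<..n}. T j j) else 0) =
    (if i = s then scale (mu * counit n tr + q) 1 else 0)"
proof -
  have "(\<Sum>k\<in>{1..n}. scale (w k) (scale (M i s) (S (t k s) * t i k)
        + (if i = s then \<Sum>j\<in>{1..n}. scale (L i j) (S (t k j) * t j k) else 0))) =
      (\<Sum>k\<in>{1..n}. scale (w k) (scale q (t i k * S (t k s)) + (\<Sum>l\<in>{1..n}. scale (L l k) (t i l * S (t l s)))))"
    using assms by (intro sum.cong refl) (simp only: frt_antipode_relation M_diag simp_thms if_True)
  moreover have "(\<Sum>k\<in>{1..n}. scale (w k) (scale (M i s) (S (t k s) * t i k)
        + (if i = s then \<Sum>j\<in>{1..n}. scale (L i j) (S (t k j) * t j k) else 0))) =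
      scale (M i s) (T i s) + (if i = s then scale mu (\<Sum>j\<in>{i<..n}. T j j) else 0)"
  proof -
    have "(\<Sum>k\<in>{1..n}. scale (w k) (\<Sum>j\<in>{1..n}. scale (L i j) (S (t k j) * t j k))) =
        (\<Sum>j\<in>{1..n}. scale (L i j) (T j j))"
      unfolding T_def scale_sum_right by (subst sum.swap) (simp add: mult.commute)
    also have "\<dots> = (\<Sum>j\<in>{i<..n}. scale mu (T j j))"
      by (intro sum.mono_neutral_cong_right) (auto simp: L_eq)
    finally have "(\<Sum>k\<in>{1..n}. scale (w k) (\<Sum>j\<in>{1..n}. scale (L i j) (S (t k j) * t j k))) =
        scale mu (\<Sum>j\<in>{i<..n}. T j j)"
      by (simp add: scale_sum_right)
    moreover have "(\<Sum>k\<in>{1..n}. scale (w k) (scale (M i s) (S (t k s) * t i k))) = scale (M i s) (T i s)"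
      by (simp add: T_def scale_sum_right mult.commute)
    ultimately show ?thesis
      by (cases "i = s") (simp_all only: scale_right_distrib sum.distrib simp_thms if_True if_False scale_zero_right sum.neutral_const)
  qed
  moreover have "(\<Sum>k\<in>{1..n}. scale (w k) (scale q (t i k * S (t k s)) + (\<Sum>l\<in>{1..n}. scale (L l k) (t i l * S (t l s))))) =
      (if i = s then scale (mu * counit n tr + q) 1 else 0)"
  proof -
    have "(\<Sum>k\<in>{1..n}. scale (w k) (\<Sum>l\<in>{1..n}. scale (L l k) (t i l * S (t l s)))) =
        (\<Sum>l\<in>{1..n}. scale (\<Sum>k\<in>{1..n}. w k * L l k) (t i l * S (t l s)))"
      unfolding scale_sum_right scale_sum_left by (subst sum.swap) simp
    also have "\<dots> = (\<Sum>l\<in>{1..n}. scale (mu * counit n tr - q * w l + q) (t i l * S (t l s)))"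
    proof (intro sum.cong refl)
      fix l assume "l \<in> {1..n}"
      then have "(\<Sum>k\<in>{1..n}. w k * L l k) = (\<Sum>k\<in>{l<..n}. mu * w k)"
        by (intro sum.mono_neutral_cong_right) (auto simp: L_eq)
      then show "scale (\<Sum>k\<in>{1..n}. w k * L l k) (t i l * S (t l s)) =
          scale (mu * counit n tr - q * w l + q) (t i l * S (t l s))"
        using \<open>l \<in> {1..n}\<close> mu_counit_tr[of l] by (simp flip: sum_distrib_left)
    qed
    finally have "(\<Sum>k\<in>{1..n}. scale (w k) (scale q (t i k * S (t k s)) + (\<Sum>l\<in>{1..n}. scale (L l k) (t i l * S (t l s))))) =
        (\<Sum>l\<in>{1..n}. scale (w l * q) (t i l * S (t l s)) + scale (mu * counit n tr - q * w l + q) (t i l * S (t l s)))"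
      by (simp add: scale_right_distrib sum.distrib)
    also have "\<dots> = scale (mu * counit n tr + q) (\<Sum>l\<in>{1..n}. t i l * S (t l s))"
      unfolding scale_sum_right
      by (intro sum.cong refl) (simp add: mult.commute flip: scale_left_distrib)
    finally show ?thesis
      using assms by (simp add: antipode_gen_right del: One_nat_def)
  qed
  ultimately show ?thesis
    by (simp only:)
qed

text \<open>Descending induction on \<open>i\<close>: \<open>T_relation\<close> expresses
  \<open>T i i\<close> through the \<open>T j j\<close> with \<open>j > i\<close>.\<close>

lemma T_diag:
  assumes "i \<in> {1..n}"
  shows "T i i = scale (w i) 1"
  using assms
proof (induction "n - i" arbitrary: i rule: less_induct)
  case less
  have "(\<Sum>j\<in>{i<..n}. T j j) = (\<Sum>j\<in>{i<..n}. scale (w j) 1)"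
    using less.prems by (intro sum.cong refl less.hyps) auto
  then have "scale mu (\<Sum>j\<in>{i<..n}. T j j) = scale (mu * counit n tr - q * w i + q) 1"
    using mu_counit_tr[of i] less.prems by (simp flip: scale_sum_left)
  then have "scale q (T i i) + scale (mu * counit n tr - q * w i + q) 1 = scale (mu * counit n tr + q) 1"
    using T_relation[of i i] less.prems by simp
  then have "scale q (T i i) = scale (mu * counit n tr + q) 1 - scale (mu * counit n tr - q * w i + q) 1"
    by (simp add: eq_diff_eq)
  also have "\<dots> = scale q (scale (w i) 1)"
    by (simp flip: scale_left_diff_distrib)
  finally show ?case
    by (simp only: scale_cancel_left q_nonzero simp_thms)
qed

lemma T_off_diag:
  assumes "i \<in> {1..n}" "s \<in> {1..n}" "i \<noteq> s"
  shows "T i s = 0"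
  using T_relation[of i s] M_nonzero[of i s] assms by simp

section \<open>Pure tensors and the coaction on the two summands\<close>

lemma lookup_pure_tensor: "Poly_Mapping.lookup (pure_tensor scale x a) b = scale (Poly_Mapping.lookup x b) a"
  by (simp add: pure_tensor_def Poly_Mapping.map.rep_eq when_def)

lemma pure_tensor_smult: "pure_tensor scale (smult c x) a = pure_tensor scale x (scale c a)"
  by (rule poly_mapping_eqI) (simp add: lookup_pure_tensor mult.commute)

lemma pure_tensor_diff_left: "pure_tensor scale (x - y) a = pure_tensor scale x a - pure_tensor scale y a"
  by (rule poly_mapping_eqI) (simp add: lookup_pure_tensor lookup_minus scale_left_diff_distrib)

lemma pure_tensor_sum_right: "pure_tensor scale x (\<Sum>i\<in>A. f i) = (\<Sum>i\<in>A. pure_tensor scale x (f i))"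
  by (rule poly_mapping_eqI) (simp add: lookup_pure_tensor lookup_sum scale_sum_right)

lemma pure_tensor_zero [simp]: "pure_tensor scale x 0 = 0"
  by (rule poly_mapping_eqI) (simp add: lookup_pure_tensor)

lemma pure_tensor_mem: "x \<in> W \<Longrightarrow> pure_tensor scale x a \<in> tensor_with scale W"
  unfolding tensor_with_def by (rule CollectI, rule exI[of _ 1], rule exI[of _ "\<lambda>_. x"], rule exI[of _ "\<lambda>_. a"]) simp

lemma tensor_with_zero: "0 \<in> tensor_with scale W"
  unfolding tensor_with_def by (rule CollectI, rule exI[of _ 0]) simp

text \<open>The two finite families of pure tensors are concatenated, the second one shifted by
  \<open>m\<close>.\<close>

lemma tensor_with_add:
  assumes "x \<in> tensor_with scale W" "y \<in> tensor_with scale W"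
  shows "x + y \<in> tensor_with scale W"
proof -
  obtain m :: nat and v a where x: "x = (\<Sum>i<m. pure_tensor scale (v i) (a i))" "\<forall>i<m. v i \<in> W"
    using assms(1) unfolding tensor_with_def by blast
  obtain m' :: nat and v' a' where y: "y = (\<Sum>i<m'. pure_tensor scale (v' i) (a' i))" "\<forall>i<m'. v' i \<in> W"
    using assms(2) unfolding tensor_with_def by blast
  define v'' where "v'' i = (if i < m then v i else v' (i - m))" for i
  define a'' where "a'' i = (if i < m then a i else a' (i - m))" for i
  have "(\<Sum>i<m + m'. f i) = (\<Sum>i<m. f i) + (\<Sum>i<m'. f (m + i))" for f :: "nat \<Rightarrow> (nat \<times> nat) \<Rightarrow>\<^sub>0 'a"
    by (induction m') (simp_all add: add.assoc)
  then have "(\<Sum>i<m + m'. pure_tensor scale (v'' i) (a'' i)) = x + y"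
    by (simp add: x y v''_def a''_def)
  then have "x + y = (\<Sum>i<m + m'. pure_tensor scale (v'' i) (a'' i))"
    by (rule sym)
  moreover have "\<forall>i<m + m'. v'' i \<in> W"
    using x y by (auto simp: v''_def)
  ultimately have "\<exists>(m :: nat) v a. x + y = (\<Sum>i<m. pure_tensor scale (v i) (a i)) \<and> (\<forall>i<m. v i \<in> W)"
    by (intro exI[of _ "m + m'"] exI[of _ v''] exI[of _ a''] conjI)
  then show ?thesis
    by (simp only: tensor_with_def mem_Collect_eq)
qed

lemma tensor_with_sum:
  assumes "\<And>i. i \<in> A \<Longrightarrow> f i \<in> tensor_with scale W"
  shows "(\<Sum>i\<in>A. f i) \<in> tensor_with scale W"
  using assms by (induction A rule: infinite_finite_induct) (simp_all add: tensor_with_zero tensor_with_add)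

text \<open>Moving the sum over \<open>i\<close> inside makes \<open>T b a\<close> appear as the
  coefficient of \<open>X a b\<close>, and its values turn the result into \<open>tr\<close>
  tensored with \<open>1\<close>.\<close>

lemma coaction_tr: "coaction scale n t S (smult c tr) = pure_tensor scale (smult c tr) 1"
proof -
  have tr: "Poly_Mapping.lookup tr (i, j) = (if i = j \<and> i \<in> {1..n} then w i else 0)" for i j
  proof -
    have "Poly_Mapping.lookup tr (i, j) = (\<Sum>a\<in>{1..n}. if a = i then if i = j then w i else 0 else 0)"
      unfolding qtr_def lookup_sum by (intro sum.cong refl) (simp add: lookup_X)
    then show ?thesis
      by simp
  qed
  have "coaction scale n t S (smult c tr) =
      (\<Sum>i\<in>{1..n}. \<Sum>a\<in>{1..n}. \<Sum>b\<in>{1..n}. pure_tensor scale (X a b) (scale (c * w i) (S (t i a) * t b i)))"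
    unfolding coaction_def
  proof (rule sum.cong[OF refl])
    fix i assume i: "i \<in> {1..n}"
    have "(\<Sum>a\<in>{1..n}. \<Sum>b\<in>{1..n}. pure_tensor scale (smult (Poly_Mapping.lookup (smult c tr) (i, j)) (X a b)) (S (t i a) * t b j)) =
      (if j = i then \<Sum>a\<in>{1..n}. \<Sum>b\<in>{1..n}. pure_tensor scale (X a b) (scale (c * w i) (S (t i a) * t b i)) else 0)" for j
      using i by (simp add: tr pure_tensor_smult)
    then show "(\<Sum>j\<in>{1..n}. \<Sum>a\<in>{1..n}. \<Sum>b\<in>{1..n}. pure_tensor scale (smult (Poly_Mapping.lookup (smult c tr) (i, j)) (X a b)) (S (t i a) * t b j)) =
      (\<Sum>a\<in>{1..n}. \<Sum>b\<in>{1..n}. pure_tensor scale (X a b) (scale (c * w i) (S (t i a) * t b i)))"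
      using i by simp
  qed
  also have "\<dots> = (\<Sum>a\<in>{1..n}. \<Sum>i\<in>{1..n}. \<Sum>b\<in>{1..n}. pure_tensor scale (X a b) (scale (c * w i) (S (t i a) * t b i)))"
    by (rule sum.swap)
  also have "\<dots> = (\<Sum>a\<in>{1..n}. \<Sum>b\<in>{1..n}. \<Sum>i\<in>{1..n}. pure_tensor scale (X a b) (scale (c * w i) (S (t i a) * t b i)))"
    by (intro sum.cong refl sum.swap)
  also have "\<dots> = (\<Sum>a\<in>{1..n}. \<Sum>b\<in>{1..n}. pure_tensor scale (X a b) (scale c (T b a)))"
    by (simp add: T_def pure_tensor_sum_right scale_sum_right)
  also have "\<dots> = (\<Sum>a\<in>{1..n}. \<Sum>b\<in>{1..n}. if b = a then pure_tensor scale (X a a) (scale (c * w a) 1) else 0)"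
    by (intro sum.cong refl) (auto simp: T_diag T_off_diag)
  also have "\<dots> = (\<Sum>a\<in>{1..n}. pure_tensor scale (smult (c * w a) (X a a)) 1)"
    by (simp add: pure_tensor_smult)
  also have "\<dots> = pure_tensor scale (smult c tr) 1"
    by (rule poly_mapping_eqI)
      (simp add: lookup_pure_tensor lookup_sum qtr_def sum_distrib_left mult.assoc flip: scale_sum_left)
  finally show ?thesis .
qed

text \<open>Replacing each \<open>X a b\<close> by an element of the kernel leaves a remainder along
  \<open>X 1 1\<close>. By the antipode axiom this remainder is the counit of \<open>x\<close>,
  which is zero.\<close>

lemma coaction_sl:
  assumes "x \<in> sl n"
  shows "coaction scale n t S x \<in> tensor_with scale (sl n)"
proof -
  define c where "c i j a b = scale (Poly_Mapping.lookup x (i, j)) (S (t i a) * t b j)" for i j a b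
  \<comment> \<open>\<open>Y a b\<close> is the projection of \<open>X a b\<close> to the kernel of
    the counit along \<open>X 1 1\<close>.\<close>
  define Y where "Y a b = (X a b - smult (delta a b) (X 1 1) :: (nat \<times> nat) \<Rightarrow>\<^sub>0 'k)" for a b
  have "coaction scale n t S x = (\<Sum>i\<in>{1..n}. \<Sum>j\<in>{1..n}. \<Sum>a\<in>{1..n}. \<Sum>b\<in>{1..n}.
      pure_tensor scale (Y a b) (c i j a b) + (if b = a then pure_tensor scale (X 1 1) (c i j a a) else 0))"
    unfolding coaction_def
    by (intro sum.cong refl)
      (auto simp: Y_def c_def delta_def pure_tensor_smult pure_tensor_diff_left)
  also have "\<dots> = (\<Sum>i\<in>{1..n}. \<Sum>j\<in>{1..n}. \<Sum>a\<in>{1..n}. \<Sum>b\<in>{1..n}. pure_tensor scale (Y a b) (c i j a b))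
      + pure_tensor scale (X 1 1) (\<Sum>i\<in>{1..n}. \<Sum>j\<in>{1..n}. \<Sum>a\<in>{1..n}. c i j a a)"
    by (simp add: sum.distrib pure_tensor_sum_right)
  also have "(\<Sum>i\<in>{1..n}. \<Sum>j\<in>{1..n}. \<Sum>a\<in>{1..n}. c i j a a) = scale (counit n x) 1"
  proof -
    have "(\<Sum>a\<in>{1..n}. c i j a a) = scale (Poly_Mapping.lookup x (i, j) * delta i j) 1"
      if "i \<in> {1..n}" "j \<in> {1..n}" for i j
      unfolding c_def scale_sum_right[symmetric] antipode_gen_left[OF that] by (simp add: delta_def)
    then show ?thesis
      by (simp add: counit_def scale_sum_left)
  qed
  also have "counit n x = 0"
    using assms by (simp add: sl_def)
  finally have "coaction scale n t S x =
      (\<Sum>i\<in>{1..n}. \<Sum>j\<in>{1..n}. \<Sum>a\<in>{1..n}. \<Sum>b\<in>{1..n}. pure_tensor scale (Y a b) (c i j a b))"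
    by simp
  moreover have "Y a b \<in> sl n" if "a \<in> {1..n}" "b \<in> {1..n}" for a b
  proof -
    have "1 \<in> {1..n}"
      using that by auto
    then show ?thesis
      using that
      by (simp add: sl_def Y_def counit_diff counit_smult counit_X delta_def X_in_sl_tilde
          pm.subspace_diff pm.subspace_scale subspace_sl_tilde)
  qed
  ultimately show ?thesis
    by (auto intro!: tensor_with_sum pure_tensor_mem)
qed

end

section \<open>Brackets of root vectors and Cartan elements\<close>

context R_matrix_data
begin

lemma mu_qint: "mu\<^sup>2 * qint q k = mu\<^sup>2 * ((\<Sum>a\<in>{1..k}. w a) / q\<^sup>2)"
  using qint_eq_sum[of k] by (simp add: field_simps)

lemma bracket_h_h:
  assumes "i \<in> {1..<n}" "j \<in> {1..<n}"
  shows "br (h i) (h j) = br (X i i) (X j j) - br (X i i) (X (Suc j) (Suc j))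
    - br (X (Suc i) (Suc i)) (X j j) + br (X (Suc i) (Suc i)) (X (Suc j) (Suc j))"
  by (simp add: h_def bracket_diff_left bracket_diff_right)

text \<open>Of the four brackets of diagonal elements, that of \<open>X i i\<close> with its
  successor has no correction term. Unfolding \<open>K (Suc i)\<close> by \<open>K_Suc\<close> then
  collects everything in terms of \<open>K i\<close> and \<open>h i\<close>.\<close>

lemma bracket_h_same:
  assumes "i \<in> {1..<n}"
  shows "br (h i) (h i) =
    - smult (mu\<^sup>2 * qint q 2 * q powi (- 2 * int i)) (H q i)
    - smult (mu\<^sup>2 * q powi (- 2 * int i) * qint q (i + 1)) (h i)"
proof -
  define s where "s = (\<Sum>a\<in>{1..i}. w a)"
  have qint_2: "mu\<^sup>2 * qint q 2 = mu\<^sup>2 * (1 + q\<^sup>2)"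
    unfolding mu_qint by (simp add: numeral_2_eq_2 add_divide_distrib)
  have "mu\<^sup>2 * qint q (Suc i) = mu\<^sup>2 * (s / q\<^sup>2 + w i)"
    unfolding mu_qint by (simp add: s_def add_divide_distrib power2_eq_square)
  then have 1: "mu\<^sup>2 * q powi (- 2 * int i) * qint q (i + 1) = mu\<^sup>2 * (s / q\<^sup>2 + w i) * inverse (w i)"
    unfolding powi_w by (simp add: mult_ac)
  have 2: "smult (mu\<^sup>2 * qint q 2 * q powi (- 2 * int i)) (H q i) =
      smult (mu\<^sup>2 * ((1 + q\<^sup>2) * inverse (w i) / q\<^sup>2)) (K i)"
    unfolding powi_w qint_2 mult.assoc smult_H' by simp
  have "br (h i) (h i) = - smult (mu\<^sup>2 * inverse (w i)) (K i) - smult (mu\<^sup>2) (h i)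
      - smult (mu\<^sup>2 * inverse (w (Suc i))) (K i + smult s (h i))"
    unfolding bracket_h_h[OF assms assms] using assms
    by (simp add: bracket_X_X_diag h_def s_def K_Suc del: power_Suc mult_Suc_right)
  also have "\<dots> = - smult (mu\<^sup>2 * ((1 + q\<^sup>2) * inverse (w i) / q\<^sup>2)) (K i)
      - smult (mu\<^sup>2 * (s / q\<^sup>2 + w i) * inverse (w i)) (h i)"
  proof (rule poly_mapping_eqI)
    fix b
    \<comment> \<open>Here \<open>m\<close>, \<open>v\<close>, \<open>Q\<close>, \<open>V\<close>
      and \<open>W\<close> stand for \<open>mu^2\<close>, \<open>inverse (w i)\<close>,
      \<open>q^2\<close>, its inverse and \<open>w i\<close>; \<open>x\<close> and \<open>y\<close>
      are the coefficients of \<open>K i\<close> and \<open>h i\<close>.\<close>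
    have *: "- (m * v * x) - m * y - m * (V * v) * (x + s * y) =
        - (m * ((1 + Q) * v * V) * x) - m * (s * V + W) * v * y"
      if "Q * V = 1" "W * v = 1" for m v x y Q V W :: 'k
    proof -
      have e: "m * ((1 + Q) * v * V) * x = m * v * x * V + m * v * x * (Q * V)"
        "m * (s * V + W) * v * y = m * v * s * V * y + m * (W * v) * y"
        by (simp_all add: algebra_simps)
      show ?thesis
        unfolding e that by (simp add: algebra_simps)
    qed
    show "Poly_Mapping.lookup (- smult (mu\<^sup>2 * inverse (w i)) (K i) - smult (mu\<^sup>2) (h i)
        - smult (mu\<^sup>2 * inverse (w (Suc i))) (K i + smult s (h i))) b =
      Poly_Mapping.lookup (- smult (mu\<^sup>2 * ((1 + q\<^sup>2) * inverse (w i) / q\<^sup>2)) (K i)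
      - smult (mu\<^sup>2 * (s / q\<^sup>2 + w i) * inverse (w i)) (h i)) b"
      unfolding w_Suc divide_inverse inverse_mult_distrib lookup_minus lookup_uminus lookup_add lookup_smult
      by (rule *) simp_all
  qed
  finally show ?thesis
    unfolding 1 2 .
qed

text \<open>Only the bracket of the shared element \<open>X (i + 1) (i + 1)\<close> with itself
  leaves a correction, a multiple of \<open>K (i + 1)\<close>; everything else cancels.\<close>

lemma bracket_h_Suc:
  assumes "i \<in> {1..<n}" "Suc i \<in> {1..<n}"
  shows "br (h i) (h (Suc i)) = smult (mu\<^sup>2 * q powi (- 2 * int i)) (H q (Suc i))"
proof -
  have "br (h i) (h (Suc i)) = smult (mu\<^sup>2 * inverse (w (Suc i))) (K (Suc i))"
    unfolding bracket_h_h[OF assms] using assms by (simp add: bracket_X_X_diag)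
  then show ?thesis
    unfolding powi_w smult_H' w_Suc by (simp add: divide_inverse mult_ac)
qed

text \<open>The corrections for decreasing indices cancel among themselves, so again only the shared
  diagonal element contributes. The exponent is written in terms of the larger index.\<close>

lemma bracket_Suc_h:
  assumes "i \<in> {1..<n}" "Suc i \<in> {1..<n}"
  shows "br (h (Suc i)) (h i) = smult (mu\<^sup>2 * q powi (- 2 * (int (Suc i) - 1))) (H q (Suc i))"
proof -
  have "br (h (Suc i)) (h i) = smult (mu\<^sup>2 * inverse (w (Suc i))) (K (Suc i))"
    unfolding bracket_h_h[OF assms(2,1)] using assms
    by (simp add: bracket_X_X_diag pm.scale_right_diff_distrib)
  then show ?thesis
    unfolding powi_w smult_H' by simp
qed

lemma bracket_h_far:
  assumes "i \<in> {1..<n}" "j \<in> {1..<n}" "\<bar>int i - int j\<bar> > 1"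
  shows "br (h i) (h j) = 0"
proof -
  consider "Suc i < j" | "Suc j < i"
    using assms(3) by linarith
  then show ?thesis
    by cases (use assms in \<open>simp_all add: bracket_h_h bracket_X_X_diag pm.scale_right_diff_distrib\<close>)
qed

text \<open>Diagonal elements act on \<open>X k l\<close> by scalars, so \<open>h i\<close> acts by
  a difference. The \<open>mu^2\<close> present for all indices beyond \<open>l\<close> cancels
  except at \<open>l = i\<close>, where it turns \<open>q\<close> into
  \<open>q - mu = inverse q\<close>.\<close>

lemma bracket_h_X:
  assumes "i \<in> {1..<n}" "k \<in> {1..n}" "l \<in> {1..n}" "k \<noteq> l"
  shows "br (h i) (X k l) =
    smult (mu * (q powi (- 2 * int i) * (inverse q * delta k (i + 1) - q * delta k i)
      + inverse q * delta l i - q * delta l (i + 1))) (X k l)"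
proof -
  define c where "c i = 1 + (if i = l then mu * q else if l < i then mu\<^sup>2 else 0) - (if i = k then mu * q / w k else 0)" for i
  have "br (X a a) (X k l) = smult (c a) (X k l)" if "a \<in> {1..n}" for a
    using assms that by (simp add: bracket_X bracket_gen_diag_left c_def)
  then have "br (h i) (X k l) = smult (c i - c (Suc i)) (X k l)"
    using assms by (simp add: h_def bracket_diff_left pm.scale_left_diff_distrib)
  also have "c i - c (Suc i) = mu * (q powi (- 2 * int i) * (inverse q * delta k (i + 1) - q * delta k i)
      + inverse q * delta l i - q * delta l (i + 1))"
  proof -
    have "c i - c (Suc i) = mu * ((if k = Suc i then q / w (Suc i) else 0) - (if k = i then q / w i else 0)
        + (if l = i then q - mu else 0) - (if l = Suc i then q else 0))"
      by (auto simp: c_def algebra_simps power2_eq_square simp del: mult_Suc_right)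
    also have "q / w (Suc i) = inverse (w i) * inverse q"
      by (simp add: w_Suc power2_eq_square divide_inverse del: mult_Suc_right)
    also have "q - mu = inverse q"
      by (simp add: mu_def)
    finally show ?thesis
      unfolding powi_w by (auto simp: delta_def divide_inverse mult_ac)
  qed
  finally show ?thesis .
qed

text \<open>As for \<open>bracket_h_X\<close>, but with the step at \<open>k\<close>: the jump
  occurs at \<open>k = i + 1\<close> and turns \<open>inverse q\<close> into
  \<open>inverse q + mu = q\<close>.\<close>

lemma bracket_X_h:
  assumes "i \<in> {1..<n}" "k \<in> {1..n}" "l \<in> {1..n}" "k \<noteq> l"
  shows "br (X k l) (h i) =
    smult (mu * (inverse q * delta k i - q * delta k (i + 1)
      + q powi (- 2 * int i) * (inverse q * delta l (i + 1) - q * delta l i))) (X k l)"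
proof -
  define c where "c i = mu * ((if i = k then inverse q else 0) - (if i = l then q / w l else 0) - (if i < k then mu else 0))" for i
  have "br (X k l) (X a a) = smult (c a) (X k l)" if "a \<in> {1..n}" for a
    using assms that by (simp add: bracket_X bracket_gen_diag_right c_def)
  then have "br (X k l) (h i) = smult (c i - c (Suc i)) (X k l)"
    using assms by (simp add: h_def bracket_diff_right pm.scale_left_diff_distrib)
  also have "c i - c (Suc i) = mu * (inverse q * delta k i - q * delta k (i + 1)
      + q powi (- 2 * int i) * (inverse q * delta l (i + 1) - q * delta l i))"
  proof -
    have "c i - c (Suc i) = mu * ((if k = i then inverse q else 0) - (if k = Suc i then inverse q + mu else 0)
        + ((if l = Suc i then q / w (Suc i) else 0) - (if l = i then q / w i else 0)))"
      by (auto simp: c_def algebra_simps simp del: mult_Suc_right)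
    also have "q / w (Suc i) = inverse (w i) * inverse q"
      by (simp add: w_Suc power2_eq_square divide_inverse del: mult_Suc_right)
    also have "inverse q + mu = q"
      by (simp add: mu_def)
    finally show ?thesis
      unfolding powi_w by (auto simp: delta_def divide_inverse mult_ac)
  qed
  finally show ?thesis .
qed

text \<open>The cases \<open>j \<noteq> k\<close>, \<open>j = k\<close> with
  \<open>i \<noteq> l\<close>, and \<open>j = k\<close> with \<open>i = l\<close> are merged into
  one formula. For \<open>j = k\<close> the coefficient \<open>sigma_coeff\<close> is
  \<open>0\<close>; for \<open>j \<noteq> k\<close> and \<open>i = l\<close> the indices
  \<open>i\<close>, \<open>j\<close>, \<open>k\<close> are distinct.\<close>

lemma bracket_X_X:
  assumes "i \<in> {1..n}" "j \<in> {1..n}" "k \<in> {1..n}" "l \<in> {1..n}" "i \<noteq> j" "k \<noteq> l"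
  shows "br (X i j) (X k l) =
    - smult (q * mu * q powi (- 2 * int j) * delta k j) (X i l)
    + smult (mu * delta i l * sigma_coeff q r i j k) (X k j)
    + smult (q * mu * delta i l * delta j k * q powi (- 2 * int k)) (X k k)
    - smult (mu\<^sup>2 * delta i l * delta j k * q powi (- 2 * (int k - 1))) (H q k)"
proof (cases "j = k")
  case False
  then have "sigma_coeff q r i j k = M j i / (M k i * M j k)" if "i = l"
    using that assms by (intro sigma_coeff_eq_M) auto
  then show ?thesis
    using assms False by (simp add: bracket_X bracket_gen_off_diag delta_def)
next
  case True
  show ?thesis
  proof (cases "i = l")
    case False
    then show ?thesis
      unfolding powi_w using True assms
      by (simp add: bracket_X bracket_gen_composable delta_def divide_inverse mult_ac)
  next
    case il: True
    have "smult (mu\<^sup>2 * (q\<^sup>2 * inverse (w k))) (H q k) = smult (mu\<^sup>2 / w k) (K k)"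
      unfolding smult_H' by (simp add: divide_inverse)
    moreover have "sigma_coeff q r i j k = 0"
      using True by (simp add: sigma_coeff_def)
    ultimately show ?thesis
      unfolding powi_w using True il assms
      by (simp add: bracket_X bracket_gen_opposite delta_def divide_inverse mult_ac
          pm.scale_right_diff_distrib)
  qed
qed

end

lemma (in SL_quantum_group_R) subcomodule_tr: "subcomodule scale n t S (pm.span {tr})"
proof -
  have "coaction scale n t S x \<in> tensor_with scale (pm.span {tr})" if x: "x \<in> pm.span {tr}" for x
  proof -
    obtain c where "x = smult c tr"
      using x unfolding pm.span_singleton by blast
    then show ?thesis
      using x by (simp add: coaction_tr pure_tensor_mem)
  qed
  moreover have "pm.span {tr} \<subseteq> sl_tilde n"
    by (intro pm.span_minimal subspace_sl_tilde) (simp add: tr_in_sl_tilde)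
  ultimately show ?thesis
    by (simp add: subcomodule_def)
qed

lemma (in SL_quantum_group_R) subcomodule_sl: "subcomodule scale n t S (sl n)"
  by (auto simp: subcomodule_def subspace_sl coaction_sl) (simp add: sl_def)

lemma is_direct_sum_tr_sl:
  assumes "counit n (qtr n q) \<noteq> 0"
  shows "is_direct_sum (sl_tilde n) (pm.span {qtr n q}) (sl n)"
proof -
  let ?tr = "qtr n q"
  have "x \<in> {u + v | u v. u \<in> pm.span {?tr} \<and> v \<in> sl n}" if "x \<in> sl_tilde n" for x
  proof -
    \<comment> \<open>Applying the counit to the desired decomposition forces this coefficient of
      the trace.\<close>
    define c where "c = counit n x / counit n ?tr"
    have "x - smult c ?tr \<in> sl n"
      using that assms
      by (simp add: sl_def counit_diff counit_smult c_def pm.subspace_diff pm.subspace_scale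
          subspace_sl_tilde tr_in_sl_tilde)
    moreover have "smult c ?tr \<in> pm.span {?tr}"
      by (simp add: pm.span_scale pm.span_base)
    moreover have "x = smult c ?tr + (x - smult c ?tr)"
      by simp
    ultimately show ?thesis
      by blast
  qed
  moreover have span: "pm.span {?tr} \<subseteq> sl_tilde n"
    by (intro pm.span_minimal subspace_sl_tilde) (simp add: tr_in_sl_tilde)
  ultimately have "sl_tilde n = {u + v | u v. u \<in> pm.span {?tr} \<and> v \<in> sl n}"
    using pm.subspace_add[OF subspace_sl_tilde] unfolding sl_def by blast
  moreover have "pm.span {?tr} \<inter> sl n = {0}"
  proof -
    have "x = 0" if "x \<in> pm.span {?tr}" "x \<in> sl n" for x
    proof -
      obtain c where "x = smult c ?tr"
        using \<open>x \<in> pm.span {?tr}\<close> unfolding pm.span_singleton by blast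
      then show ?thesis
        using \<open>x \<in> sl n\<close> assms by (simp add: sl_def counit_smult)
    qed
    then show ?thesis
      using pm.span_zero pm.subspace_0[OF subspace_sl] by blast
  qed
  ultimately show ?thesis
    by (simp add: is_direct_sum_def subspace_sl)
qed

theorem proposition5p7:
  fixes n :: nat and q :: "'k::field" and r :: "nat \<Rightarrow> nat \<Rightarrow> 'k"
  assumes "q \<noteq> 0" and "r_params n q r" and "counit n (qtr n q) \<noteq> 0"
  defines "\<mu> \<equiv> q - inverse q"
    and "br \<equiv> bracket n q r"
    and "tr \<equiv> qtr n q"
  shows
    "is_direct_sum (sl_tilde n) (pm.span {tr}) (sl n)
     \<and> (\<forall>(scale :: 'k \<Rightarrow> 'a::ring_1 \<Rightarrow> 'a) t S. SL_quantum_group scale n q r t S \<longrightarrow>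
          subcomodule scale n t S (pm.span {tr}) \<and> subcomodule scale n t S (sl n))
     \<and> sl n = pm.span ({X i j | i j. i \<in> {1..n} \<and> j \<in> {1..n} \<and> i \<noteq> j} \<union> {h k | k. k \<in> {1..<n}})
     \<and> (\<forall>x\<in>sl n. br x tr = 0)
     \<and> br tr tr = smult (counit n tr) tr
     \<and> (\<forall>x\<in>sl n. br tr x = smult (counit n tr * (1 + \<mu>^2)) x)
     \<and> (\<forall>i\<in>{1..<n}.
          br (h i) (h i) =
            - smult (\<mu>^2 * qint q 2 * q powi (- 2 * int i)) (H q i)
            - smult (\<mu>^2 * q powi (- 2 * int i) * qint q (i + 1)) (h i))
     \<and> (\<forall>i. i \<in> {1..<n} \<and> i + 1 \<in> {1..<n} \<longrightarrow>
          br (h i) (h (i + 1)) = smult (\<mu>^2 * q powi (- 2 * int i)) (H q (i + 1)))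
     \<and> (\<forall>i. i \<in> {1..<n} \<and> i - 1 \<in> {1..<n} \<longrightarrow>
          br (h i) (h (i - 1)) = smult (\<mu>^2 * q powi (- 2 * (int i - 1))) (H q i))
     \<and> (\<forall>i\<in>{1..<n}. \<forall>j\<in>{1..<n}. \<bar>int i - int j\<bar> > 1 \<longrightarrow> br (h i) (h j) = 0)
     \<and> (\<forall>i\<in>{1..<n}. \<forall>k\<in>{1..n}. \<forall>l\<in>{1..n}. k \<noteq> l \<longrightarrow>
          br (h i) (X k l) =
            smult (\<mu> * (q powi (- 2 * int i) * (inverse q * delta k (i + 1) - q * delta k i)
                        + inverse q * delta l i - q * delta l (i + 1))) (X k l)
          \<and> br (X k l) (h i) =
            smult (\<mu> * (inverse q * delta k i - q * delta k (i + 1)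
                        + q powi (- 2 * int i) * (inverse q * delta l (i + 1) - q * delta l i)))
              (X k l))
     \<and> (\<forall>i\<in>{1..n}. \<forall>j\<in>{1..n}. \<forall>k\<in>{1..n}. \<forall>l\<in>{1..n}. i \<noteq> j \<and> k \<noteq> l \<longrightarrow>
          br (X i j) (X k l) =
            - smult (q * \<mu> * q powi (- 2 * int j) * delta k j) (X i l)
            + smult (\<mu> * delta i l * sigma_coeff q r i j k) (X k j)
            + smult (q * \<mu> * delta i l * delta j k * q powi (- 2 * int k)) (X k k)
            - smult (\<mu>^2 * delta i l * delta j k * q powi (- 2 * (int k - 1))) (H q k))"
proof -
  interpret R_matrix_data n q r
    using assms(1,2) by unfold_locales (auto simp: r_params_def)
  have mu: "\<mu> = mu"
    by (simp add: \<mu>_def mu_def)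
  have sl_tilde: "x \<in> sl_tilde n" "counit n x = 0" if "x \<in> sl n" for x :: "(nat \<times> nat) \<Rightarrow>\<^sub>0 'k"
    using that by (simp_all add: sl_def)
  have subcomodules: "subcomodule scale n t S (pm.span {tr}) \<and> subcomodule scale n t S (sl n)"
    if "SL_quantum_group scale n q r t S" for scale :: "'k \<Rightarrow> 'a \<Rightarrow> 'a" and t S
  proof -
    interpret SL_quantum_group scale n q r t S
      by (rule that)
    interpret SL_quantum_group_R scale n q r t S ..
    show ?thesis
      unfolding tr_def using subcomodule_tr subcomodule_sl ..
  qed
  have tr_tr: "br tr tr = smult (counit n tr) tr"
    unfolding br_def tr_def by (rule bracket_tr_right[OF tr_in_sl_tilde])
  have x_tr: "br x tr = 0" if "x \<in> sl n" for x
    using sl_tilde[OF that] unfolding br_def tr_def by (simp add: bracket_tr_right)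
  have tr_x: "br tr x = smult (counit n tr * (1 + \<mu>^2)) x" if "x \<in> sl n" for x
    using sl_tilde[OF that] unfolding br_def tr_def mu by (simp add: bracket_tr_left)
  \<comment> \<open>This is \<open>bracket_Suc_h\<close> reindexed; the assumption on
    \<open>i - 1\<close> excludes truncated subtraction.\<close>
  have h_pred: "br (h i) (h (i - 1)) = smult (\<mu>^2 * q powi (- 2 * (int i - 1))) (H q i)"
    if "i \<in> {1..<n}" "i - 1 \<in> {1..<n}" for i
    using bracket_Suc_h[of "i - 1"] that unfolding br_def mu by (cases i) simp_all
  show ?thesis
    using is_direct_sum_tr_sl[OF assms(3)] subcomodules sl_eq_span x_tr tr_tr tr_x
      bracket_h_same bracket_h_Suc h_pred bracket_h_far bracket_h_X bracket_X_h bracket_X_X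
    unfolding br_def tr_def mu by (intro conjI ballI allI impI) simp_all
qed

end
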